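(* Consider the bilevel problem, the regularity assumptions and the bilevel stochastic gradient (BSG) method described in the context. Suppose that there are positive constants $V_d,L_{BSG},\bar L_{LL},C_w,C_D,C_e$ such that for all $k$: (i) $\mathbb{E}_{\xi_k}[\|d(x_k,w(x_k),\xi_k)\|^2]\le V_d$; (ii) for any pair of data $(D_1)_k,(D_2)_k$, whose directions are computed with residual errors $(r_1)_k,(r_2)_k$, $\|d((D_1)_k)-d((D_2)_k)\|\le L_{BSG}(\|(D_1)_k-(D_2)_k\|+\|(r_1)_k-(r_2)_k\|)$, and moreover $\|D(x_k,w(x_k),\xi_k)-D(x_k,\tilde w_k,\xi_k)\|\le\bar L_{LL}\|w(x_k)-\tilde w_k\|$, where $\bar L_{LL}$ depends only on the Lipschitz constants of the stochastic gradients, Hessians and Jacobians; (iii) $\mathbb{E}_{\xi_k^{\rm S1}}[\|w(x_k)-\tilde w_k\|^2]\le(C_w\alpha_k)^2$; (iv) $\mathbb{E}_{\xi_k^{\rm all}}[\|D(x_k,\tilde w_k)-D(x_k,\tilde w_k,\xi_k)\|]\le C_D\alpha_k$; (v) for all realizations of the algorithm, every residual $r_k$ (either $(r_1)_k$ or $(r_2)_k$ in (ii)) satisfies $\|r_k\|\le C_e\alpha_k$. Suppose further that the iterates are contained in a bounded set, with $\Theta<\infty$ a positive constant such that $\|x_{k_1}-x_{k_2}\|\le\Theta$ for all $k_1,k_2$, that $f$ is continuously differentiable and convex, i.e. $f(\bar x)\ge f(x)+\nabla f(x)^\top(\bar x-x)$ for all $x,\bar x\in\mathbb{R}^n$, and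 that $f$ attains a minimizer on $X$. Let $x_*$ be such a minimizer and let the step sizes be $\alpha_k=\bar\alpha/\sqrt k$, $k\ge1$, with $\bar\alpha>0$. Then for all $k\ge1$ $$\min_{s=0,\dots,k}\mathbb{E}[f(x_s)]-f(x_* )\le\frac{\frac{\Theta^2}{2\bar\alpha}+\bar\alpha(G_d+2C_d\Theta)}{\sqrt k},$$ where $G_d,C_d$ are the constants defined in the context.
   Context: All vector and matrix norms are $\ell_2$ norms; tuples of vectors and matrices carry a fixed product norm. Gradients are columns, $\nabla g^\top$ denotes the Jacobian of a vector map $g$, and $\nabla^2_{xy}f_\ell$ is the $n\times m$ matrix of mixed second derivatives. Bilevel problem. $X\subseteq\mathbb{R}^n$ is closed and convex; $f_u:\mathbb{R}^n\times\mathbb{R}^m\to\mathbb{R}$ is continuously differentiable and $f_\ell:\mathbb{R}^n\times\mathbb{R}^m\to\mathbb{R}$ is twice continuously differentiable. The lower-level (LL) problem at $x$ is $\min_{y\in Y(x)}f_\ell(x,y)$, where either $Y(x)=\mathbb{R}^m$ (LL unconstrained case) or $Y(x)=\{y\in\mathbb{R}^m: c_i(x,y)\le0,\ i\in I;\ c_i(x,y)=0,\ i\in E\}$ with $I,E$ finite and each $c_i$ twice continuously differentiable (LL constrained case). The LL problem has a unique optimal solution $y(x)$. Set $f(x)=f_u(x,y(x))$; the bilevel problem is $\min_{x\in X}f(x)$. The result covers both cases. Unified notation. In the unconstrained case $w=y$ and $w(x)=y(x)$. In the constrained case, $c_I=(c_i)_{i\in I}$, $c_E=(c_i)_{i\in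 E}$, $\mathcal{L}_\ell(x,y,z)=f_\ell(x,y)+c_I(x,y)^\top z_I+c_E(x,y)^\top z_E$, $w=v=(y,z_I,z_E)$, $w(x)=v(x)=(y(x),z_I(x),z_E(x))$ with $z_I(x),z_E(x)$ the LL KKT multipliers, and $G(x,v)=(\nabla_y\mathcal{L}_\ell(x,y,z),\ z_I\circ c_I(x,y),\ c_E(x,y))$ ($\circ$ is the entrywise product), so $G(x,v(x))=0$; $L=(\mathbf{I}_m\ \mathbf{0})^\top$ with $\mathbf{0}$ of size $m\times(|I|+|E|)$. Data: $D=(a,b,A,B)$. Deterministic data: $D(x,w)=(\nabla_xf_u,\nabla_yf_u,\nabla^2_{xy}f_\ell,\nabla^2_{yy}f_\ell)$ at $(x,y)$ in the unconstrained case, and $D(x,w)=(\nabla_xf_u(x,y),L\nabla_yf_u(x,y),\nabla_xG(x,v),\nabla_vG(x,v))$ in the constrained case. Stochastic data $D(x,w,\xi)$: the same with stochastic estimates $g^u_x,g^u_y,H^\ell_{xy},H^\ell_{yy}$ (resp. $g^u_x,Lg^u_y,\mathcal{G}_x,\mathcal{G}_v$) depending on a random variable $\xi$. The direction associated with $D$ is $d(D)=-(a-AB^{-1}b)$, possibly computed inexactly with a residual error $r$: either $B\lambda=b$ is solved inexactly with residual $\tilde r$, giving $-(a-AB^{-1}(b+\tilde r))$, or $B^{-1}$ is replaced by a truncated Neumann series $B^{-1}-\tilde R$, giving $-(a-A(B^{-1}-\tilde R)b)$. Write $d(x,w)=d(D(x,w))$, $d(x,w,\xi)=d(D(x,w,\xi))$,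 and $d(x,w(x))=-\nabla f(x)$, the gradient of $f$ being $\nabla f(x)=a-AB^{-1}b$ with data $D(x,w(x))$. Regularity assumptions. Unconstrained case: $\nabla f_u,\nabla^2_{xy}f_\ell,\nabla^2_{yy}f_\ell$ are Lipschitz continuous; they and their stochastic estimates are bounded at all points; $\nabla_yf_\ell(x,y(x))=0$ and $\nabla^2_{yy}f_\ell$ and $H^\ell_{yy}$ are positive definite at all points; $(\nabla^2_{yy}f_\ell)^{-1}$ and $(H^\ell_{yy})^{-1}$ are uniformly bounded. Constrained case: $\nabla f_u,\nabla c_I^\top,\nabla c_E^\top,\nabla^2_{xy}f_\ell,\nabla^2_{yy}f_\ell,\nabla^2_{yx}c_i,\nabla^2_{yy}c_i$ ($i\in I\cup E$) are Lipschitz continuous; they and their stochastic estimates are uniformly bounded; the multipliers $z$ and their stochastic counterparts are uniformly bounded; $y(x)$ satisfies the LL KKT conditions with multipliers $(z_I(x),z_E(x))$ such that the linear independence constraint qualification, strict complementarity and the second-order sufficient condition hold; $(\nabla_vG)^{-1}$ and $\mathcal{G}_v^{-1}$ are uniformly bounded at all points. BSG method. Given an initial $(x_0,\tilde w_0)$ and positive step sizes $\{\alpha_k\}$, at each iteration $k$: (1) obtain an approximation $\tilde w_k$ of $w(x_k)$, using random variables $\xi_k^{\rm S1}$; (2) compute $d(x_k,\tilde w_k,\xi_k)$ using random variables $\xi_k$; (3) set $x_{k+1}=P_X(x_k+\alpha_kd(x_k,\tilde w_k,\xi_k))$, where $P_X$ is the orthogonal projection onto $X$. Here iterations are indexed by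 $k=1,2,\dots$ and start from $x_1:=x_0$. Put $\xi_k^{\rm all}=(\xi_k^{\rm S1},\xi_k)$, with $\xi_k^{\rm S1}$ and $\xi_k$ independent. $\mathbb{E}_{\xi_k},\mathbb{E}_{\xi_k^{\rm S1}},\mathbb{E}_{\xi_k^{\rm all}}$ are expectations with respect to the indicated variables given $x_k$; $\mathbb{E}$ is the expectation with respect to all of them. Constants. $C_s>0$ is an upper bound for all $\alpha_k$; $G_d=2(U_d+V_d)$ with $U_d=L_{BSG}^2C_s^2(\bar L_{LL}^2C_w^2+4\bar L_{LL}C_eC_w+4C_e^2)$; $C_d=L_{BSG}(L_{LL}C_w+C_D+4C_e)$, where $L_{LL}>0$ (depending only on the Lipschitz constants of the gradients, Hessians and Jacobians in the regularity assumptions) satisfies $\|D(x_k,w(x_k))-D(x_k,\tilde w_k)\|\le L_{LL}\|w(x_k)-\tilde w_k\|$. *)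

theory Defs
  imports "HOL-Probability.Probability"
begin

section \<open>Calculus\<close>

definition grad :: "('a::euclidean_space \<Rightarrow> real) \<Rightarrow> 'a \<Rightarrow> 'a" where
  "grad g x = (THE D. GDERIV g x :> D)"

text \<open>Gradients are columns, so for a vector map the gradient is the transposed Jacobian.\<close>

definition nabla :: "(real^'a \<Rightarrow> real^'b) \<Rightarrow> real^'a \<Rightarrow> real^'b^'a" where
  "nabla h x = transpose (jacobian h (at x))"

definition cont_diff :: "('a::euclidean_space \<Rightarrow> 'b::real_normed_vector) \<Rightarrow> bool" where
  "cont_diff g \<longleftrightarrow>
     (\<exists>g'. (\<forall>x. (g has_derivative blinfun_apply (g' x)) (at x)) \<and> continuous_on UNIV g')"

definition twice_cont_diff :: "('a::euclidean_space \<Rightarrow> 'b::real_normed_vector) \<Rightarrow> bool" where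
  "twice_cont_diff g \<longleftrightarrow>
     (\<exists>g'. (\<forall>x. (g has_derivative blinfun_apply (g' x)) (at x)) \<and> cont_diff g')"

definition Lipschitz :: "('a::metric_space \<Rightarrow> 'b::metric_space) \<Rightarrow> bool" where
  "Lipschitz g \<longleftrightarrow> (\<exists>K. K-lipschitz_on UNIV g)"

definition grad_x :: "((real^'n) \<times> (real^'m) \<Rightarrow> real) \<Rightarrow> real^'n \<Rightarrow> real^'m \<Rightarrow> real^'n" where
  "grad_x g x y = grad (\<lambda>x'. g (x', y)) x"

definition grad_y :: "((real^'n) \<times> (real^'m) \<Rightarrow> real) \<Rightarrow> real^'n \<Rightarrow> real^'m \<Rightarrow> real^'m" where
  "grad_y g x y = grad (\<lambda>y'. g (x, y')) y"

definition hess_xy :: "((real^'n) \<times> (real^'m) \<Rightarrow> real) \<Rightarrow> real^'n \<Rightarrow> real^'m \<Rightarrow> real^'m^'n" where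
  "hess_xy g x y = nabla (\<lambda>x'. grad_y g x' y) x"

definition hess_yx :: "((real^'n) \<times> (real^'m) \<Rightarrow> real) \<Rightarrow> real^'n \<Rightarrow> real^'m \<Rightarrow> real^'n^'m" where
  "hess_yx g x y = nabla (\<lambda>y'. grad_x g x y') y"

definition hess_yy :: "((real^'n) \<times> (real^'m) \<Rightarrow> real) \<Rightarrow> real^'n \<Rightarrow> real^'m \<Rightarrow> real^'m^'m" where
  "hess_yy g x y = nabla (\<lambda>y'. grad_y g x y') y"

definition pos_def :: "real^'a^'a \<Rightarrow> bool" where
  "pos_def B \<longleftrightarrow> (\<forall>u. u \<noteq> 0 \<longrightarrow> 0 < u \<bullet> (B *v u))"

text \<open>The explicit invertibility matters: \<^const>\<open>matrix_inv\<close> is an arbitrary value on singular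
  matrices.\<close>

definition unif_bounded_inverse :: "(real^'a^'a) set \<Rightarrow> bool" where
  "unif_bounded_inverse \<B> \<longleftrightarrow> (\<forall>B\<in>\<B>. invertible B) \<and> bounded (matrix_inv ` \<B>)"


section \<open>Data, norms and directions\<close>

text \<open>The \<^const>\<open>norm\<close> of the library on matrices is the Frobenius norm; the matrix norm used
  here is the one induced by the Euclidean vector norm.\<close>

definition mnorm :: "real^'a^'b \<Rightarrow> real" where
  "mnorm A = onorm (\<lambda>u. A *v u)"

type_synonym ('n, 'p) data = "(real^'n) \<times> (real^'p) \<times> (real^'p^'n) \<times> (real^'p^'p)"

text \<open>The product norm on data is not prescribed: it is any norm of the four component norms that
  is monotone on the nonnegative orthant.\<close>

definition product_norm :: "(real \<times> real \<times> real \<times> real \<Rightarrow> real) \<Rightarrow> bool" where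
  "product_norm \<nu> \<longleftrightarrow>
     (\<forall>s. \<nu> s = 0 \<longleftrightarrow> s = 0) \<and>
     (\<forall>c s. \<nu> (c *\<^sub>R s) = \<bar>c\<bar> * \<nu> s) \<and>
     (\<forall>s t. \<nu> (s + t) \<le> \<nu> s + \<nu> t) \<and>
     (\<forall>a b c d a' b' c' d'.
        0 \<le> a \<and> a \<le> a' \<and> 0 \<le> b \<and> b \<le> b' \<and> 0 \<le> c \<and> c \<le> c' \<and> 0 \<le> d \<and> d \<le> d'
          \<longrightarrow> \<nu> (a, b, c, d) \<le> \<nu> (a', b', c', d'))"

definition data_norm ::
  "(real \<times> real \<times> real \<times> real \<Rightarrow> real) \<Rightarrow> ('n::finite, 'p::finite) data \<Rightarrow> real" where
  "data_norm \<nu> D = (case D of (a, b, A, B) \<Rightarrow> \<nu> (norm a, norm b, mnorm A, mnorm B))"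

datatype inexactness = Inexact_Solve | Truncated_Neumann

text \<open>A residual is a pair of a vector (the residual of the linear system) and a matrix (the
  remainder of the Neumann series), of which only the component belonging to the chosen kind of
  inexactness is used. The zero residual gives the exact direction.\<close>

type_synonym 'p residual = "(real^'p) \<times> (real^'p^'p)"

definition residual_norm :: "inexactness \<Rightarrow> 'p::finite residual \<Rightarrow> real" where
  "residual_norm \<kappa> r = (case \<kappa> of Inexact_Solve \<Rightarrow> norm (fst r) | Truncated_Neumann \<Rightarrow> mnorm (snd r))"

definition direction ::
  "inexactness \<Rightarrow> ('n::finite, 'p::finite) data \<Rightarrow> 'p residual \<Rightarrow> real^'n" where
  "direction \<kappa> D r = (case D of (a, b, A, B) \<Rightarrow>
     (case \<kappa> of
        Inexact_Solve \<Rightarrow> - (a - A *v (matrix_inv B *v (b + fst r)))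
      | Truncated_Neumann \<Rightarrow> - (a - A *v ((matrix_inv B - snd r) *v b))))"


section \<open>The bilevel stochastic gradient method\<close>

text \<open>The four data at an iteration: deterministic or stochastic, at \<open>w(x\<^sub>k)\<close> or at its
  approximation.\<close>

datatype datum = Det_Opt | Det_Approx | Sto_Opt | Sto_Approx

text \<open>Parameters: \<open>S\<close>, \<open>T\<close> are the value spaces of the random variables \<open>\<xi>1 k\<close> (used for the lower
  level) and \<open>\<xi> k\<close>; \<open>w\<close> is the map \<open>x \<mapsto> w(x)\<close>; \<open>D\<close> and \<open>D\<xi>\<close> are the deterministic and the
  stochastic data; \<open>LL k\<close> produces the approximation \<open>wt k\<close> of \<open>w (x k)\<close>, possibly warm-started at
  \<open>wt (k - 1)\<close>; \<open>\<rho> k i\<close> is the residual in the direction computed from the datum \<open>i\<close>.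
  Since \<open>d(x, w(x))\<close> is the exact negative gradient, the residual of \<^const>\<open>Det_Opt\<close> is zero.\<close>

locale bsg_method = prob_space M for M :: "'o measure" +
  fixes S :: "'s measure" and T :: "'t measure"
    and \<xi>1 :: "nat \<Rightarrow> 'o \<Rightarrow> 's" and \<xi> :: "nat \<Rightarrow> 'o \<Rightarrow> 't"
    and X :: "(real^'n::finite) set"
    and x0 :: "real^'n" and x :: "nat \<Rightarrow> 'o \<Rightarrow> real^'n" and \<alpha> :: "nat \<Rightarrow> real"
    and w :: "real^'n \<Rightarrow> real^'p::finite"
    and D :: "real^'n \<Rightarrow> real^'p \<Rightarrow> ('n, 'p) data"
    and D\<xi> :: "real^'n \<Rightarrow> real^'p \<Rightarrow> 't \<Rightarrow> ('n, 'p) data"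
    and LL :: "nat \<Rightarrow> real^'n \<Rightarrow> real^'p \<Rightarrow> 's \<Rightarrow> real^'p"
    and w0 :: "real^'p" and wt :: "nat \<Rightarrow> 'o \<Rightarrow> real^'p"
    and \<kappa> :: inexactness and \<rho> :: "nat \<Rightarrow> datum \<Rightarrow> 'o \<Rightarrow> 'p residual"
begin

fun datum_at :: "nat \<Rightarrow> datum \<Rightarrow> 'o \<Rightarrow> ('n, 'p) data" where
  "datum_at k Det_Opt \<omega> = D (x k \<omega>) (w (x k \<omega>))"
| "datum_at k Det_Approx \<omega> = D (x k \<omega>) (wt k \<omega>)"
| "datum_at k Sto_Opt \<omega> = D\<xi> (x k \<omega>) (w (x k \<omega>)) (\<xi> k \<omega>)"
| "datum_at k Sto_Approx \<omega> = D\<xi> (x k \<omega>) (wt k \<omega>) (\<xi> k \<omega>)"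

definition dir_at :: "nat \<Rightarrow> datum \<Rightarrow> 'o \<Rightarrow> real^'n" where
  "dir_at k i \<omega> = direction \<kappa> (datum_at k i \<omega>) (\<rho> k i \<omega>)"

text \<open>Conditional expectation given \<open>x\<^sub>k\<close> of a nonnegative quantity. It is taken in
  \<^typ>\<open>ennreal\<close>, so that an upper bound entails integrability.\<close>

definition cond_exp_given :: "nat \<Rightarrow> ('o \<Rightarrow> real) \<Rightarrow> 'o \<Rightarrow> ennreal" where
  "cond_exp_given k Z = nn_cond_exp M (vimage_algebra (space M) (x k) borel) (\<lambda>\<omega>. ennreal (Z \<omega>))"

end

text \<open>The measurability clauses only say that the quantities whose expectations are taken are
  random variables. Independence of \<open>\<xi>1 k\<close> and \<open>\<xi> k\<close> is that of their generated sigma-algebras, because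
  the library's \<open>indep_var\<close> requires both variables to have the same value type.\<close>

locale bsg_run = bsg_method +
  assumes \<xi>1_rv: "\<And>k. 1 \<le> k \<Longrightarrow> \<xi>1 k \<in> measurable M S"
    and \<xi>_rv: "\<And>k. 1 \<le> k \<Longrightarrow> \<xi> k \<in> measurable M T"
    and indep: "\<And>k. 1 \<le> k \<Longrightarrow> 
          indep_set (sets (vimage_algebra (space M) (\<xi>1 k) S))
                    (sets (vimage_algebra (space M) (\<xi> k) T))"
    and x_rv: "\<And>k. x k \<in> borel_measurable M"
    and w_rv: "\<And>k. 1 \<le> k \<Longrightarrow> (\<lambda>\<omega>. w (x k \<omega>)) \<in> borel_measurable M"
    and wt_rv: "\<And>k. 1 \<le> k \<Longrightarrow> wt k \<in> borel_measurable M"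
    and datum_rv: "\<And>k i. 1 \<le> k \<Longrightarrow> datum_at k i \<in> borel_measurable M"
    and dir_rv: "\<And>k i. 1 \<le> k \<Longrightarrow> dir_at k i \<in> borel_measurable M"
    and x_init: "\<And>\<omega>. \<omega> \<in> space M \<Longrightarrow> x 0 \<omega> = x0 \<and> x 1 \<omega> = x0"
    and wt_init: "\<And>\<omega>. \<omega> \<in> space M \<Longrightarrow> wt 0 \<omega> = w0"
    and wt_step: "\<And>k \<omega>. 1 \<le> k \<Longrightarrow> \<omega> \<in> space M \<Longrightarrow>
                    wt k \<omega> = LL k (x k \<omega>) (wt (k - 1) \<omega>) (\<xi>1 k \<omega>)"
    and x_step: "\<And>k \<omega>. 1 \<le> k \<Longrightarrow> \<omega> \<in> space M \<Longrightarrow>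
                    x (Suc k) \<omega> = closest_point X (x k \<omega> + \<alpha> k *\<^sub>R dir_at k Sto_Approx \<omega>)"
    and exact: "\<And>k \<omega>. 1 \<le> k \<Longrightarrow> \<omega> \<in> space M \<Longrightarrow> \<rho> k Det_Opt \<omega> = 0"

locale bsg_assumptions = bsg_run +
  fixes \<nu> :: "real \<times> real \<times> real \<times> real \<Rightarrow> real"
    and V\<^sub>d L_BSG L_LL L_LL_bar C_w C_D C_e :: real
  assumes norm_\<nu>: "product_norm \<nu>"
    and positive: "0 < V\<^sub>d" "0 < L_BSG" "0 < L_LL" "0 < L_LL_bar" "0 < C_w" "0 < C_D" "0 < C_e"
    and L_LL: "\<And>k \<omega>. 1 \<le> k \<Longrightarrow> \<omega> \<in> space M \<Longrightarrow>
          data_norm \<nu> (datum_at k Det_Opt \<omega> - datum_at k Det_Approx \<omega>)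
            \<le> L_LL * norm (w (x k \<omega>) - wt k \<omega>)"
    and bounded_second_moment: "\<And>k. 1 \<le> k \<Longrightarrow>
          AE \<omega> in M. cond_exp_given k (\<lambda>\<omega>. (norm (dir_at k Sto_Opt \<omega>))\<^sup>2) \<omega> \<le> ennreal V\<^sub>d"
    and direction_Lipschitz: "\<And>k i j \<omega>. 1 \<le> k \<Longrightarrow> \<omega> \<in> space M \<Longrightarrow>
          norm (dir_at k i \<omega> - dir_at k j \<omega>)
            \<le> L_BSG * (data_norm \<nu> (datum_at k i \<omega> - datum_at k j \<omega>)
                        + residual_norm \<kappa> (\<rho> k i \<omega> - \<rho> k j \<omega>))"
    and stochastic_data_Lipschitz: "\<And>k \<omega>. 1 \<le> k \<Longrightarrow> \<omega> \<in> space M \<Longrightarrow>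
          data_norm \<nu> (datum_at k Sto_Opt \<omega> - datum_at k Sto_Approx \<omega>)
            \<le> L_LL_bar * norm (w (x k \<omega>) - wt k \<omega>)"
    and LL_accuracy: "\<And>k. 1 \<le> k \<Longrightarrow>
          AE \<omega> in M. cond_exp_given k (\<lambda>\<omega>. (norm (w (x k \<omega>) - wt k \<omega>))\<^sup>2) \<omega>
                       \<le> ennreal ((C_w * \<alpha> k)\<^sup>2)"
    and data_accuracy: "\<And>k. 1 \<le> k \<Longrightarrow>
          AE \<omega> in M. cond_exp_given k
                       (\<lambda>\<omega>. data_norm \<nu> (datum_at k Det_Approx \<omega> - datum_at k Sto_Approx \<omega>)) \<omega>
                       \<le> ennreal (C_D * \<alpha> k)"
    and residual_bound: "\<And>k i \<omega>. 1 \<le> k \<Longrightarrow> \<omega> \<in> space M \<Longrightarrow>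
          residual_norm \<kappa> (\<rho> k i \<omega>) \<le> C_e * \<alpha> k"

definition const_U\<^sub>d :: "real \<Rightarrow> real \<Rightarrow> real \<Rightarrow> real \<Rightarrow> real \<Rightarrow> real" where
  "const_U\<^sub>d L_BSG C_s L_LL_bar C_w C_e =
     L_BSG\<^sup>2 * C_s\<^sup>2 * (L_LL_bar\<^sup>2 * C_w\<^sup>2 + 4 * L_LL_bar * C_e * C_w + 4 * C_e\<^sup>2)"

definition const_G\<^sub>d :: "real \<Rightarrow> real \<Rightarrow> real \<Rightarrow> real \<Rightarrow> real \<Rightarrow> real \<Rightarrow> real" where
  "const_G\<^sub>d V\<^sub>d L_BSG C_s L_LL_bar C_w C_e = 2 * (const_U\<^sub>d L_BSG C_s L_LL_bar C_w C_e + V\<^sub>d)"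

definition const_C\<^sub>d :: "real \<Rightarrow> real \<Rightarrow> real \<Rightarrow> real \<Rightarrow> real \<Rightarrow> real" where
  "const_C\<^sub>d L_BSG L_LL C_w C_D C_e = L_BSG * (L_LL * C_w + C_D + 4 * C_e)"


section \<open>The lower-level problem\<close>

definition LL_unique_solution ::
  "((real^'n) \<times> (real^'m) \<Rightarrow> real) \<Rightarrow> (real^'n \<Rightarrow> (real^'m) set) \<Rightarrow> (real^'n \<Rightarrow> real^'m) \<Rightarrow> bool" where
  "LL_unique_solution fl Y y \<longleftrightarrow>
     (\<forall>x q. is_arg_min (\<lambda>y'. fl (x, y')) (\<lambda>y'. y' \<in> Y x) q \<longleftrightarrow> q = y x)"

text \<open>The adjoint formula for the gradient of the bilevel objective.\<close>

definition adjoint_gradient ::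
  "(real^'n \<Rightarrow> real) \<Rightarrow> (real^'n \<Rightarrow> real^'p) \<Rightarrow> (real^'n \<Rightarrow> real^'p \<Rightarrow> ('n, 'p) data) \<Rightarrow> bool" where
  "adjoint_gradient f w D \<longleftrightarrow>
     (\<forall>x. case D x (w x) of (a, b, A, B) \<Rightarrow> GDERIV f x :> a - A *v (matrix_inv B *v b))"

subsection \<open>Unconstrained case\<close>

definition unc_data ::
  "((real^'n) \<times> (real^'m) \<Rightarrow> real) \<Rightarrow> ((real^'n) \<times> (real^'m) \<Rightarrow> real)
    \<Rightarrow> real^'n \<Rightarrow> real^'m \<Rightarrow> ('n, 'm) data" where
  "unc_data fu fl x y = (grad_x fu x y, grad_y fu x y, hess_xy fl x y, hess_yy fl x y)"

definition unc_sdata ::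
  "(real^'n \<Rightarrow> real^'m \<Rightarrow> 't \<Rightarrow> real^'n) \<Rightarrow> (real^'n \<Rightarrow> real^'m \<Rightarrow> 't \<Rightarrow> real^'m)
    \<Rightarrow> (real^'n \<Rightarrow> real^'m \<Rightarrow> 't \<Rightarrow> real^'m^'n) \<Rightarrow> (real^'n \<Rightarrow> real^'m \<Rightarrow> 't \<Rightarrow> real^'m^'m)
    \<Rightarrow> real^'n \<Rightarrow> real^'m \<Rightarrow> 't \<Rightarrow> ('n, 'm) data" where
  "unc_sdata gux guy Hxy Hyy x y t = (gux x y t, guy x y t, Hxy x y t, Hyy x y t)"

definition estimate_bounded ::
  "'t measure \<Rightarrow> (real^'n \<Rightarrow> real^'m \<Rightarrow> 't \<Rightarrow> 'b::metric_space) \<Rightarrow> bool" where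
  "estimate_bounded T g \<longleftrightarrow> bounded {g x y t | x y t. t \<in> space T}"

definition unc_regular ::
  "((real^'n) \<times> (real^'m) \<Rightarrow> real) \<Rightarrow> ((real^'n) \<times> (real^'m) \<Rightarrow> real) \<Rightarrow> (real^'n \<Rightarrow> real^'m)
    \<Rightarrow> 't measure
    \<Rightarrow> (real^'n \<Rightarrow> real^'m \<Rightarrow> 't \<Rightarrow> real^'n) \<Rightarrow> (real^'n \<Rightarrow> real^'m \<Rightarrow> 't \<Rightarrow> real^'m)
    \<Rightarrow> (real^'n \<Rightarrow> real^'m \<Rightarrow> 't \<Rightarrow> real^'m^'n) \<Rightarrow> (real^'n \<Rightarrow> real^'m \<Rightarrow> 't \<Rightarrow> real^'m^'m)
    \<Rightarrow> bool" where
  "unc_regular fu fl y T gux guy Hxy Hyy \<longleftrightarrow>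
     Lipschitz (grad fu) \<and> Lipschitz (\<lambda>(x, y). hess_xy fl x y) \<and> Lipschitz (\<lambda>(x, y). hess_yy fl x y) \<and>
     bounded (range (grad fu)) \<and> bounded (range (\<lambda>(x, y). hess_xy fl x y)) \<and>
     bounded (range (\<lambda>(x, y). hess_yy fl x y)) \<and>
     estimate_bounded T gux \<and> estimate_bounded T guy \<and>
     estimate_bounded T Hxy \<and> estimate_bounded T Hyy \<and>
     (\<forall>x. grad_y fl x (y x) = 0) \<and>
     (\<forall>x y. pos_def (hess_yy fl x y)) \<and> (\<forall>x y. \<forall>t\<in>space T. pos_def (Hyy x y t)) \<and>
     unif_bounded_inverse {hess_yy fl x y | x y. True} \<and>
     unif_bounded_inverse {Hyy x y t | x y t. t \<in> space T}"

subsection \<open>Constrained case\<close>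

text \<open>The constraints are indexed by a finite type \<open>'c\<close>, which is the disjoint union of \<open>I\<close>
  (inequalities) and \<open>E\<close> (equalities); either set may be empty. The vector \<open>v = (y, z\<^sub>I, z\<^sub>E)\<close> is
  indexed by \<open>'m + 'c\<close>.\<close>

definition vjoin :: "real^'m \<Rightarrow> real^'c \<Rightarrow> real^('m + 'c)" where
  "vjoin y z = (\<chi> s. case s of Inl j \<Rightarrow> y $ j | Inr i \<Rightarrow> z $ i)"

definition ypart :: "real^('m::finite + 'c::finite) \<Rightarrow> real^'m" where
  "ypart v = (\<chi> j. v $ Inl j)"

definition zpart :: "real^('m::finite + 'c::finite) \<Rightarrow> real^'c" where
  "zpart v = (\<chi> i. v $ Inr i)"

definition feasible ::
  "'c set \<Rightarrow> 'c set \<Rightarrow> ('c \<Rightarrow> (real^'n) \<times> (real^'m) \<Rightarrow> real) \<Rightarrow> real^'n \<Rightarrow> (real^'m) set" where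
  "feasible I E c x = {y. (\<forall>i\<in>I. c i (x, y) \<le> 0) \<and> (\<forall>i\<in>E. c i (x, y) = 0)}"

definition Lagrangian ::
  "'c set \<Rightarrow> 'c set \<Rightarrow> ('c::finite \<Rightarrow> (real^'n) \<times> (real^'m) \<Rightarrow> real) \<Rightarrow> ((real^'n) \<times> (real^'m) \<Rightarrow> real)
    \<Rightarrow> real^'c \<Rightarrow> (real^'n) \<times> (real^'m) \<Rightarrow> real" where
  "Lagrangian I E c fl z p = fl p + (\<Sum>i\<in>I. c i p * z $ i) + (\<Sum>i\<in>E. c i p * z $ i)"

definition KKT_map ::
  "'c set \<Rightarrow> 'c set \<Rightarrow> ('c::finite \<Rightarrow> (real^'n) \<times> (real^'m) \<Rightarrow> real) \<Rightarrow> ((real^'n) \<times> (real^'m) \<Rightarrow> real)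
    \<Rightarrow> real^'n \<Rightarrow> real^('m + 'c) \<Rightarrow> real^('m + 'c)" where
  "KKT_map I E c fl x v = (\<chi> s. case s of
       Inl j \<Rightarrow> grad_y (Lagrangian I E c fl (zpart v)) x (ypart v) $ j
     | Inr i \<Rightarrow> if i \<in> I then zpart v $ i * c i (x, ypart v) else c i (x, ypart v))"

definition embed_y :: "real^'m^('m + 'c::finite)" where
  "embed_y = (\<chi> s j. if s = Inl j then 1 else 0)"

definition con_data ::
  "'c set \<Rightarrow> 'c set \<Rightarrow> ('c::finite \<Rightarrow> (real^'n) \<times> (real^'m) \<Rightarrow> real)
    \<Rightarrow> ((real^'n) \<times> (real^'m) \<Rightarrow> real) \<Rightarrow> ((real^'n) \<times> (real^'m) \<Rightarrow> real)
    \<Rightarrow> real^'n \<Rightarrow> real^('m + 'c) \<Rightarrow> ('n, 'm + 'c) data" where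
  "con_data I E c fu fl x v =
     (grad_x fu x (ypart v), embed_y *v grad_y fu x (ypart v),
      nabla (\<lambda>x'. KKT_map I E c fl x' v) x, nabla (\<lambda>v'. KKT_map I E c fl x v') v)"

definition con_sdata ::
  "(real^'n \<Rightarrow> real^'m \<Rightarrow> 't \<Rightarrow> real^'n) \<Rightarrow> (real^'n \<Rightarrow> real^'m \<Rightarrow> 't \<Rightarrow> real^'m)
    \<Rightarrow> (real^'n \<Rightarrow> real^('m + 'c::finite) \<Rightarrow> 't \<Rightarrow> real^('m + 'c)^'n)
    \<Rightarrow> (real^'n \<Rightarrow> real^('m + 'c) \<Rightarrow> 't \<Rightarrow> real^('m + 'c)^('m + 'c))
    \<Rightarrow> real^'n \<Rightarrow> real^('m + 'c) \<Rightarrow> 't \<Rightarrow> ('n, 'm + 'c) data" where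
  "con_sdata gux guy Gx Gv x v t =
     (gux x (ypart v) t, embed_y *v guy x (ypart v) t, Gx x v t, Gv x v t)"

definition KKT ::
  "'c set \<Rightarrow> 'c set \<Rightarrow> ('c::finite \<Rightarrow> (real^'n) \<times> (real^'m) \<Rightarrow> real) \<Rightarrow> ((real^'n) \<times> (real^'m) \<Rightarrow> real)
    \<Rightarrow> real^'n \<Rightarrow> real^'m \<Rightarrow> real^'c \<Rightarrow> bool" where
  "KKT I E c fl x y z \<longleftrightarrow>
     grad_y (Lagrangian I E c fl z) x y = 0 \<and> y \<in> feasible I E c x \<and>
     (\<forall>i\<in>I. 0 \<le> z $ i \<and> z $ i * c i (x, y) = 0)"

definition LICQ ::
  "'c set \<Rightarrow> 'c set \<Rightarrow> ('c \<Rightarrow> (real^'n) \<times> (real^'m) \<Rightarrow> real) \<Rightarrow> real^'n \<Rightarrow> real^'m \<Rightarrow> bool" where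
  "LICQ I E c x y \<longleftrightarrow>
     (let \<A> = E \<union> {i\<in>I. c i (x, y) = 0}
      in inj_on (\<lambda>i. grad_y (c i) x y) \<A> \<and> independent ((\<lambda>i. grad_y (c i) x y) ` \<A>))"

definition strict_complementarity ::
  "'c set \<Rightarrow> ('c::finite \<Rightarrow> (real^'n) \<times> (real^'m) \<Rightarrow> real) \<Rightarrow> real^'n \<Rightarrow> real^'m \<Rightarrow> real^'c \<Rightarrow> bool" where
  "strict_complementarity I c x y z \<longleftrightarrow> (\<forall>i\<in>I. c i (x, y) = 0 \<longrightarrow> 0 < z $ i)"

definition SOSC ::
  "'c set \<Rightarrow> 'c set \<Rightarrow> ('c::finite \<Rightarrow> (real^'n) \<times> (real^'m) \<Rightarrow> real) \<Rightarrow> ((real^'n) \<times> (real^'m) \<Rightarrow> real)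
    \<Rightarrow> real^'n \<Rightarrow> real^'m \<Rightarrow> real^'c \<Rightarrow> bool" where
  "SOSC I E c fl x y z \<longleftrightarrow>
     (\<forall>u. u \<noteq> 0 \<and> (\<forall>i\<in>E. grad_y (c i) x y \<bullet> u = 0) \<and>
          (\<forall>i\<in>I. c i (x, y) = 0 \<and> 0 < z $ i \<longrightarrow> grad_y (c i) x y \<bullet> u = 0) \<and>
          (\<forall>i\<in>I. c i (x, y) = 0 \<and> z $ i = 0 \<longrightarrow> grad_y (c i) x y \<bullet> u \<le> 0)
        \<longrightarrow> 0 < u \<bullet> (hess_yy (Lagrangian I E c fl z) x y *v u))"

text \<open>\<open>Gx\<close> and \<open>Gv\<close> are arbitrary estimates of the derivatives of \<^const>\<open>KKT_map\<close>. Their entries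
  consist of estimates of constraint gradients and of Hessians, combined with multipliers. Uniform
  boundedness of these estimates is therefore expressed as boundedness of the entries for
  multipliers in any bounded set. The entries of \<open>Gv\<close> in the block \<open>diag(c\<^sub>I)\<close>, which estimate
  constraint values, are exempt.\<close>

definition con_estimates_bounded ::
  "'c set \<Rightarrow> 't measure
    \<Rightarrow> (real^'n \<Rightarrow> real^'m \<Rightarrow> 't \<Rightarrow> real^'n) \<Rightarrow> (real^'n \<Rightarrow> real^'m \<Rightarrow> 't \<Rightarrow> real^'m)
    \<Rightarrow> (real^'n \<Rightarrow> real^('m + 'c::finite) \<Rightarrow> 't \<Rightarrow> real^('m + 'c)^'n)
    \<Rightarrow> (real^'n \<Rightarrow> real^('m + 'c) \<Rightarrow> 't \<Rightarrow> real^('m + 'c)^('m + 'c)) \<Rightarrow> bool" where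
  "con_estimates_bounded I T gux guy Gx Gv \<longleftrightarrow>
     estimate_bounded T gux \<and> estimate_bounded T guy \<and>
     (\<forall>K. bounded {Gx x v t | x v t. norm (zpart v) \<le> K \<and> t \<in> space T}) \<and>
     (\<forall>K r s. \<not> (\<exists>i\<in>I. r = Inr i \<and> s = Inr i) \<longrightarrow>
        bounded {Gv x v t $ r $ s | x v t. norm (zpart v) \<le> K \<and> t \<in> space T})"

definition con_regular ::
  "'c set \<Rightarrow> 'c set \<Rightarrow> ('c::finite \<Rightarrow> (real^'n) \<times> (real^'m) \<Rightarrow> real)
    \<Rightarrow> ((real^'n) \<times> (real^'m) \<Rightarrow> real) \<Rightarrow> ((real^'n) \<times> (real^'m) \<Rightarrow> real)
    \<Rightarrow> (real^'n \<Rightarrow> real^'m) \<Rightarrow> (real^'n \<Rightarrow> real^'c) \<Rightarrow> 't measure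
    \<Rightarrow> (real^'n \<Rightarrow> real^'m \<Rightarrow> 't \<Rightarrow> real^'n) \<Rightarrow> (real^'n \<Rightarrow> real^'m \<Rightarrow> 't \<Rightarrow> real^'m)
    \<Rightarrow> (real^'n \<Rightarrow> real^('m + 'c) \<Rightarrow> 't \<Rightarrow> real^('m + 'c)^'n)
    \<Rightarrow> (real^'n \<Rightarrow> real^('m + 'c) \<Rightarrow> 't \<Rightarrow> real^('m + 'c)^('m + 'c)) \<Rightarrow> bool" where
  "con_regular I E c fu fl y z T gux guy Gx Gv \<longleftrightarrow>
     Lipschitz (grad fu) \<and> (\<forall>i. Lipschitz (grad (c i))) \<and>
     Lipschitz (\<lambda>(x, y). hess_xy fl x y) \<and> Lipschitz (\<lambda>(x, y). hess_yy fl x y) \<and>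
     (\<forall>i. Lipschitz (\<lambda>(x, y). hess_yx (c i) x y) \<and> Lipschitz (\<lambda>(x, y). hess_yy (c i) x y)) \<and>
     bounded (range (grad fu)) \<and> (\<forall>i. bounded (range (grad (c i)))) \<and>
     bounded (range (\<lambda>(x, y). hess_xy fl x y)) \<and> bounded (range (\<lambda>(x, y). hess_yy fl x y)) \<and>
     (\<forall>i. bounded (range (\<lambda>(x, y). hess_yx (c i) x y)) \<and>
          bounded (range (\<lambda>(x, y). hess_yy (c i) x y))) \<and>
     con_estimates_bounded I T gux guy Gx Gv \<and>
     bounded (range z) \<and>
     (\<forall>x. KKT I E c fl x (y x) (z x) \<and> LICQ I E c x (y x) \<and>
          strict_complementarity I c x (y x) (z x) \<and> SOSC I E c fl x (y x) (z x))"

text \<open>The derivative of \<^const>\<open>KKT_map\<close> with respect to \<open>v\<close> is singular wherever a constraint and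
  its multiplier vanish together. So the conditions on inverses can only be imposed at the points
  where data are formed: \<open>(x, v(x))\<close> and the points visited by the method. The stochastic
  counterparts of the multipliers are those in the approximations \<open>wt k\<close>.\<close>

definition con_run_regular ::
  "'c set \<Rightarrow> 'c set \<Rightarrow> ('c::finite \<Rightarrow> (real^'n) \<times> (real^'m) \<Rightarrow> real) \<Rightarrow> ((real^'n) \<times> (real^'m) \<Rightarrow> real)
    \<Rightarrow> (real^'n \<Rightarrow> real^('m + 'c) \<Rightarrow> 't \<Rightarrow> real^('m + 'c)^('m + 'c))
    \<Rightarrow> (real^'n \<Rightarrow> real^('m + 'c)) \<Rightarrow> 'o measure \<Rightarrow> (nat \<Rightarrow> 'o \<Rightarrow> 't)
    \<Rightarrow> (nat \<Rightarrow> 'o \<Rightarrow> real^'n) \<Rightarrow> (nat \<Rightarrow> 'o \<Rightarrow> real^('m + 'c)) \<Rightarrow> bool" where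
  "con_run_regular I E c fl Gv w M \<xi> x wt \<longleftrightarrow>
     bounded {zpart (wt k \<omega>) | k \<omega>. 1 \<le> k \<and> \<omega> \<in> space M} \<and>
     unif_bounded_inverse
       ({nabla (KKT_map I E c fl x') (w x') | x'. True} \<union>
        {nabla (KKT_map I E c fl (x k \<omega>)) (wt k \<omega>) | k \<omega>. 1 \<le> k \<and> \<omega> \<in> space M}) \<and>
     unif_bounded_inverse
       ({Gv (x k \<omega>) (w (x k \<omega>)) (\<xi> k \<omega>) | k \<omega>. 1 \<le> k \<and> \<omega> \<in> space M} \<union>
        {Gv (x k \<omega>) (wt k \<omega>) (\<xi> k \<omega>) | k \<omega>. 1 \<le> k \<and> \<omega> \<in> space M})"

end

theory Submission
  imports Defs "HOL-Real_Asymp.Real_Asymp"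
begin

text \<open>
  The usual regret analysis of projected gradient steps bounds the sum of \<open>f (x s) - f u\<close> for any
  comparison point \<open>u\<close> in \<open>X\<close>, with a constant governed by the distances of the iterates to \<open>u\<close>.
  However, \<open>\<Theta>\<close> bounds only the distances between iterates, and the given minimizer may be
  farther away. The remedy rests on the fact that the error of the direction is \<open>O(\<alpha> s)\<close> in mean
  norm, and not only in conditional mean. Hence the analysis is pathwise, and \<open>u\<close> may depend
  arbitrarily on the whole run. A first application with the given minimizer and some finite
  distance bound shows that almost surely the infimum of \<open>f\<close> along the run is the minimum. Then a
  closure point of the run is a minimizer within \<open>\<Theta>\<close> of all iterates, and a second application
  with this random minimizer gives the stated constant.
\<close>

section \<open>Inexact projected gradient steps\<close>

text \<open>Summation by parts. As \<open>\<alpha>\<close> decreases, the nonnegative gap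
  \<open>C - a (Suc k)\<close> may be divided by \<open>\<alpha> (Suc k)\<close> instead of
  \<open>\<alpha> k\<close>; the next term then cancels \<open>a (Suc k)\<close>. Keeping the last
  \<open>a\<close> in the bound lets the induction close.\<close>

lemma weighted_telescope:
  fixes a \<alpha> :: "nat \<Rightarrow> real"
  assumes pos: "\<And>s. 1 \<le> s \<Longrightarrow> 0 < \<alpha> s"
    and decr: "\<And>s. 1 \<le> s \<Longrightarrow> \<alpha> (Suc s) \<le> \<alpha> s"
    and bound: "\<And>s. 1 \<le> s \<Longrightarrow> a s \<le> C"
    and k: "1 \<le> k"
  shows "(\<Sum>s=1..k. (a s - a (Suc s)) / \<alpha> s) \<le> (C - a (Suc k)) / \<alpha> k"
  using k
proof (induction k rule: dec_induct)
  case base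
  show ?case using bound[of 1] pos[of 1] by (simp add: divide_right_mono)
next
  case (step k)
  have "(C - a (Suc k)) / \<alpha> k \<le> (C - a (Suc k)) / \<alpha> (Suc k)"
    using step(1) bound[of "Suc k"] decr[of k] pos[of k] pos[of "Suc k"]
    by (intro divide_left_mono) auto
  with step.IH
  have "(\<Sum>s=1..Suc k. (a s - a (Suc s)) / \<alpha> s)
      \<le> (C - a (Suc k)) / \<alpha> (Suc k) + (a (Suc k) - a (Suc (Suc k))) / \<alpha> (Suc k)"
    by simp
  then show ?case by (simp add: add_divide_distrib[symmetric])
qed

lemma sum_inverse_sqrt_le: "(\<Sum>s=1..k. 1 / sqrt (real s)) \<le> 2 * sqrt (real k)"
proof (induction k)
  case (Suc k)
  \<comment> \<open>Comparison with an increment of \<open>2 * sqrt\<close>, so that the bounds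
    telescope. It comes from writing 1 as the difference of the squares of two consecutive
    roots.\<close>
  have "1 / sqrt (real (Suc k)) \<le> 2 * (sqrt (real (Suc k)) - sqrt (real k))"
  proof -
    have "1 = (sqrt (real (Suc k)) - sqrt (real k)) * (sqrt (real (Suc k)) + sqrt (real k))"
      by (simp add: algebra_simps)
    also have "\<dots> \<le> (sqrt (real (Suc k)) - sqrt (real k)) * (2 * sqrt (real (Suc k)))"
      by (intro mult_left_mono) auto
    finally show ?thesis by (simp add: field_simps)
  qed
  with Suc show ?case by simp
qed simp

text \<open>Nonexpansiveness of the projection gives a recursion for the squared distances to
  \<open>u\<close>. Here \<open>d s\<close> is an inexact \<open>- g s\<close>, and its error
  \<open>g s + d s\<close> is charged with its full norm times \<open>R\<close>. No averaging is
  involved, so \<open>u\<close> may be chosen after the whole run is known.\<close>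

lemma projected_gradient_regret:
  fixes x d g :: "nat \<Rightarrow> 'a::euclidean_space"
  assumes X: "closed X" "convex X" and u: "u \<in> X"
    and step: "\<And>s. 1 \<le> s \<Longrightarrow> x (Suc s) = closest_point X (x s + \<alpha> s *\<^sub>R d s)"
    and subgrad: "\<And>s. 1 \<le> s \<Longrightarrow> f (x s) + g s \<bullet> (u - x s) \<le> f u"
    and R: "\<And>s. 1 \<le> s \<Longrightarrow> norm (x s - u) \<le> R"
    and pos: "\<And>s. 1 \<le> s \<Longrightarrow> 0 < \<alpha> s"
    and decr: "\<And>s. 1 \<le> s \<Longrightarrow> \<alpha> (Suc s) \<le> \<alpha> s"
    and k: "1 \<le> k"
  shows "(\<Sum>s=1..k. f (x s) - f u)
    \<le> R\<^sup>2 / (2 * \<alpha> k) + (\<Sum>s=1..k. R * norm (g s + d s) + \<alpha> s / 2 * (norm (d s))\<^sup>2)"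
proof -
  define a where "a s = (norm (x s - u))\<^sup>2" for s
  have aR: "a s \<le> R\<^sup>2" if "1 \<le> s" for s
    using R[OF that] by (simp add: a_def power_mono)
  have one_step: "f (x s) - f u
      \<le> (a s - a (Suc s)) / \<alpha> s / 2 + (R * norm (g s + d s) + \<alpha> s / 2 * (norm (d s))\<^sup>2)"
    if s: "1 \<le> s" for s
  proof -
    \<comment> \<open>As \<open>u\<close> lies in \<open>X\<close>, it is its own projection, so
      projecting does not increase the distance to it.\<close>
    have "dist (closest_point X (x s + \<alpha> s *\<^sub>R d s)) (closest_point X u) \<le> dist (x s + \<alpha> s *\<^sub>R d s) u"
      using u by (intro closest_point_lipschitz X) auto
    then have "norm (x (Suc s) - u) \<le> norm (x s - u + \<alpha> s *\<^sub>R d s)"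
      using step[OF s] closest_point_self[OF u] by (simp add: dist_norm algebra_simps)
    then have "a (Suc s) \<le> (norm (x s - u + \<alpha> s *\<^sub>R d s))\<^sup>2"
      by (simp add: a_def power_mono)
    also have "\<dots> = a s + 2 * \<alpha> s * (d s \<bullet> (x s - u)) + (\<alpha> s)\<^sup>2 * (norm (d s))\<^sup>2"
      unfolding a_def power2_norm_eq_inner
      by (simp add: inner_simps inner_commute power2_eq_square algebra_simps)
    finally have 1: "a (Suc s) \<le> a s + 2 * \<alpha> s * (d s \<bullet> (x s - u)) + (\<alpha> s)\<^sup>2 * (norm (d s))\<^sup>2" .
    have "(g s + d s) \<bullet> (x s - u) \<le> norm (g s + d s) * norm (x s - u)"
      by (rule norm_cauchy_schwarz)
    also have "\<dots> \<le> R * norm (g s + d s)"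
      using R[OF s] by (subst mult.commute) (intro mult_right_mono, auto)
    finally have "d s \<bullet> (x s - u) \<le> R * norm (g s + d s) - (f (x s) - f u)"
      using subgrad[OF s] by (simp add: inner_simps)
    then have "2 * \<alpha> s * (d s \<bullet> (x s - u)) \<le> 2 * \<alpha> s * (R * norm (g s + d s) - (f (x s) - f u))"
      using pos[OF s] by (intro mult_left_mono) auto
    with 1 have "2 * \<alpha> s * (f (x s) - f u)
        \<le> a s - a (Suc s) + 2 * \<alpha> s * (R * norm (g s + d s)) + (\<alpha> s)\<^sup>2 * (norm (d s))\<^sup>2"
      by (simp add: algebra_simps)
    then show ?thesis
      using pos[OF s] by (simp add: field_simps power2_eq_square)
  qed
  have "(\<Sum>s=1..k. f (x s) - f u)
      \<le> (\<Sum>s=1..k. (a s - a (Suc s)) / \<alpha> s / 2 + (R * norm (g s + d s) + \<alpha> s / 2 * (norm (d s))\<^sup>2))"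
    using one_step by (intro sum_mono) auto
  also have "\<dots> = (\<Sum>s=1..k. (a s - a (Suc s)) / \<alpha> s) / 2
      + (\<Sum>s=1..k. R * norm (g s + d s) + \<alpha> s / 2 * (norm (d s))\<^sup>2)"
    by (simp only: sum.distrib sum_divide_distrib)
  also have "(\<Sum>s=1..k. (a s - a (Suc s)) / \<alpha> s) \<le> (R\<^sup>2 - a (Suc k)) / \<alpha> k"
    using weighted_telescope[of \<alpha> a "R\<^sup>2" k] pos decr aR k by blast
  also have "(R\<^sup>2 - a (Suc k)) / \<alpha> k \<le> R\<^sup>2 / \<alpha> k"
    using pos[OF k] by (intro divide_right_mono) (auto simp: a_def)
  finally show ?thesis by simp
qed

text \<open>Linear growth would overtake \<open>sqrt k\<close>: divide by \<open>k\<close> and pass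
  to the limit. In the application, \<open>c\<close> is the term of index 1 and \<open>z\<close> the
  excess of the expected infimum over the minimum.\<close>

lemma nonpos_of_sqrt_growth:
  fixes c z C :: real
  assumes "\<And>k. 1 \<le> k \<Longrightarrow> c + (real k - 1) * z \<le> C * sqrt (real k)"
  shows "z \<le> 0"
proof (rule LIMSEQ_le_const)
  have "(\<lambda>k. 1 / sqrt (real k)) \<longlonglongrightarrow> 0"
    by real_asymp
  moreover have "(\<lambda>k. 1 / real k) \<longlonglongrightarrow> 0"
    by real_asymp
  ultimately show "(\<lambda>k. C * (1 / sqrt (real k)) + (z - c) * (1 / real k)) \<longlonglongrightarrow> 0"
    by (intro tendsto_add_zero tendsto_mult_right_zero)
  show "\<exists>N. \<forall>k\<ge>N. z \<le> C * (1 / sqrt (real k)) + (z - c) * (1 / real k)"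
  proof (intro exI allI impI)
    fix k :: nat assume k: "1 \<le> k"
    have "real k * z \<le> C * sqrt (real k) + (z - c)"
      using assms[OF k] by (simp add: algebra_simps)
    also have "\<dots> = real k * (C * (1 / sqrt (real k)) + (z - c) * (1 / real k))"
      using k real_sqrt_mult_self[of "real k"] by (simp add: field_simps)
    finally show "z \<le> C * (1 / sqrt (real k)) + (z - c) * (1 / real k)"
      using k by simp
  qed
qed

section \<open>Expected rate of inexact projected gradient runs\<close>

text \<open>This isolates what the argument takes from the method: \<open>g\<close> yields
  subgradients, \<open>d\<close> approximates \<open>- g\<close> along the run with error of order
  \<open>\<alpha> s\<close> in mean norm, and the second moments of \<open>d\<close> are at most
  \<open>G\<close>.\<close>

locale inexact_projected_gradient = prob_space M for M :: "'o measure" +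
  fixes X :: "'a::euclidean_space set"
    and f :: "'a \<Rightarrow> real" and g :: "'a \<Rightarrow> 'a"
    and x d :: "nat \<Rightarrow> 'o \<Rightarrow> 'a" and \<alpha> :: "nat \<Rightarrow> real" and a G C :: real
  assumes closed_X: "closed X" and convex_X: "convex X"
    and f_cont: "continuous_on UNIV f"
    and subgrad: "\<And>u v. f u + g u \<bullet> (v - u) \<le> f v"
    and x_meas [measurable]: "\<And>s. x s \<in> borel_measurable M"
    and x_bounded: "bounded {x s \<omega> | s \<omega>. \<omega> \<in> space M}"
    and step: "\<And>s \<omega>. 1 \<le> s \<Longrightarrow> \<omega> \<in> space M \<Longrightarrow>
      x (Suc s) \<omega> = closest_point X (x s \<omega> + \<alpha> s *\<^sub>R d s \<omega>)"
    and a: "0 < a" and \<alpha>: "\<And>s. 1 \<le> s \<Longrightarrow> \<alpha> s = a / sqrt (real s)"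
    and G: "0 \<le> G" and C: "0 \<le> C"
    and d_int: "\<And>s. 1 \<le> s \<Longrightarrow> integrable M (\<lambda>\<omega>. (norm (d s \<omega>))\<^sup>2)"
    and d_le: "\<And>s. 1 \<le> s \<Longrightarrow> expectation (\<lambda>\<omega>. (norm (d s \<omega>))\<^sup>2) \<le> G"
    and e_int: "\<And>s. 1 \<le> s \<Longrightarrow> integrable M (\<lambda>\<omega>. norm (g (x s \<omega>) + d s \<omega>))"
    and e_le: "\<And>s. 1 \<le> s \<Longrightarrow> expectation (\<lambda>\<omega>. norm (g (x s \<omega>) + d s \<omega>)) \<le> C * \<alpha> s"
begin

text \<open>The iterates of all outcomes lie in one compact set. The common bound makes
  \<open>f\<close> integrable at each iterate and its infimum along a run finite.\<close>

lemma objective_bounded: "\<exists>F. \<forall>s. \<forall>\<omega>\<in>space M. \<bar>f (x s \<omega>)\<bar> \<le> F"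
proof -
  have "compact (f ` closure {x s \<omega> | s \<omega>. \<omega> \<in> space M})"
    using x_bounded f_cont
    by (intro compact_continuous_image) (auto simp: compact_closure intro: continuous_on_subset)
  then obtain F where "\<forall>r \<in> f ` closure {x s \<omega> | s \<omega>. \<omega> \<in> space M}. norm r \<le> F"
    using bounded_iff compact_imp_bounded by meson
  then show ?thesis
    using closure_subset[of "{x s \<omega> | s \<omega>. \<omega> \<in> space M}"] by force
qed

lemma objective_measurable [measurable]: "(\<lambda>\<omega>. f (x s \<omega>)) \<in> borel_measurable M"
  using borel_measurable_continuous_onI[OF f_cont] by measurable

lemma objective_integrable: "integrable M (\<lambda>\<omega>. f (x s \<omega>))"
proof -
  obtain F where "\<forall>s. \<forall>\<omega>\<in>space M. \<bar>f (x s \<omega>)\<bar> \<le> F"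
    using objective_bounded by blast
  then show ?thesis
    by (intro integrable_const_bound[of _ F]) (auto intro!: AE_I2)
qed

text \<open>The point \<open>u\<close> in \<open>near\<close> may depend on \<open>\<omega>\<close>; it need not be measurable, since it does not occur
  on the right-hand side of the pathwise bound.\<close>

lemma expected_regret:
  assumes R: "0 \<le> R"
    and near: "AE \<omega> in M. \<exists>u\<in>X. f u = m \<and> (\<forall>s\<ge>1. norm (x s \<omega> - u) \<le> R)"
    and k: "1 \<le> k"
  shows "(\<Sum>s=1..k. expectation (\<lambda>\<omega>. f (x s \<omega>)) - m)
    \<le> (R\<^sup>2 / (2 * a) + a * (G + 2 * C * R)) * sqrt (real k)"
proof -
  have pos: "0 < \<alpha> s" if "1 \<le> s" for s using a \<alpha> that by simp
  have decr: "\<alpha> (Suc s) \<le> \<alpha> s" if "1 \<le> s" for s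
    using a \<alpha> that by (auto intro!: divide_left_mono)
  have "(\<Sum>s=1..k. expectation (\<lambda>\<omega>. f (x s \<omega>)) - m) = expectation (\<lambda>\<omega>. \<Sum>s=1..k. f (x s \<omega>) - m)"
    using objective_integrable by (subst Bochner_Integration.integral_sum) (auto simp: prob_space)
  also have "\<dots> \<le> expectation (\<lambda>\<omega>. R\<^sup>2 / (2 * \<alpha> k)
      + (\<Sum>s=1..k. R * norm (g (x s \<omega>) + d s \<omega>) + \<alpha> s / 2 * (norm (d s \<omega>))\<^sup>2))"
  proof (rule integral_mono_AE)
    \<comment> \<open>Each outcome uses its own comparison point \<open>u\<close>, which enters the
      left side only through the common value \<open>f u = m\<close>.\<close>
    show "AE \<omega> in M. (\<Sum>s=1..k. f (x s \<omega>) - m) \<le> R\<^sup>2 / (2 * \<alpha> k)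
      + (\<Sum>s=1..k. R * norm (g (x s \<omega>) + d s \<omega>) + \<alpha> s / 2 * (norm (d s \<omega>))\<^sup>2)"
      using near AE_space
    proof eventually_elim
      case (elim \<omega>)
      then obtain u where u: "u \<in> X" "f u = m" "\<And>s. 1 \<le> s \<Longrightarrow> norm (x s \<omega> - u) \<le> R" by auto
      show ?case
        unfolding u(2)[symmetric]
        by (rule projected_gradient_regret[OF closed_X convex_X u(1)])
          (use elim u k step subgrad pos decr in auto)
    qed
  qed (use objective_integrable d_int e_int in \<open>auto intro!: Bochner_Integration.integrable_add
        Bochner_Integration.integrable_sum Bochner_Integration.integrable_diff\<close>)
  also have "\<dots> = R\<^sup>2 / (2 * \<alpha> k) + (\<Sum>s=1..k. R * expectation (\<lambda>\<omega>. norm (g (x s \<omega>) + d s \<omega>))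
      + \<alpha> s / 2 * expectation (\<lambda>\<omega>. (norm (d s \<omega>))\<^sup>2))"
    using d_int e_int
    by (subst Bochner_Integration.integral_add)
      (auto simp: prob_space Bochner_Integration.integral_sum intro!: sum.cong)
  also have "\<dots> \<le> R\<^sup>2 / (2 * \<alpha> k) + (\<Sum>s=1..k. R * (C * \<alpha> s) + \<alpha> s / 2 * G)"
    using R d_le e_le pos
    by (intro add_left_mono sum_mono add_mono mult_left_mono) (auto simp: less_imp_le)
  also have "(\<Sum>s=1..k. R * (C * \<alpha> s) + \<alpha> s / 2 * G)
      = a * (C * R + G / 2) * (\<Sum>s=1..k. 1 / sqrt (real s))"
    unfolding sum_distrib_left by (intro sum.cong) (auto simp: \<alpha> algebra_simps add_divide_distrib)
  \<comment> \<open>The factor 2 from the sum of inverse roots turns \<open>C * R + G / 2\<close>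
    into \<open>G + 2 * C * R\<close>.\<close>
  also have "\<dots> \<le> a * (C * R + G / 2) * (2 * sqrt (real k))"
    using a R G C by (intro mult_left_mono sum_inverse_sqrt_le) auto
  also have "R\<^sup>2 / (2 * \<alpha> k) + \<dots> = (R\<^sup>2 / (2 * a) + a * (G + 2 * C * R)) * sqrt (real k)"
    unfolding \<alpha>[OF k] using a k by (simp add: field_simps)
  finally show ?thesis by simp
qed

text \<open>Steps start at index 1, so index 2 is the first one that a projection onto
  \<open>X\<close> is sure to have produced.\<close>

lemma iterate_in_X:
  assumes "X \<noteq> {}" "2 \<le> s" "\<omega> \<in> space M"
  shows "x s \<omega> \<in> X"
  using assms step[of "s - 1" \<omega>] closest_point_in_set[OF closed_X] by (simp add: Suc_diff_le)

text \<open>The expected infimum is below every term of a sum of \<open>k\<close> expected values that grows only like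
  \<open>sqrt k\<close>. The term of index 1 is split off because the starting point may lie outside \<open>X\<close>.\<close>

lemma infimum_along_iterates:
  assumes min: "is_arg_min f (\<lambda>u. u \<in> X) x_star"
  shows "AE \<omega> in M. (INF s\<in>{2..}. f (x s \<omega>)) = f x_star"
proof -
  have x_star: "x_star \<in> X" and least: "\<And>u. u \<in> X \<Longrightarrow> f x_star \<le> f u"
    using min by (auto simp: is_arg_min_linorder)
  obtain F where F: "\<And>s \<omega>. \<omega> \<in> space M \<Longrightarrow> \<bar>f (x s \<omega>)\<bar> \<le> F"
    using objective_bounded by blast
  obtain B where B: "\<And>s \<omega>. \<omega> \<in> space M \<Longrightarrow> norm (x s \<omega>) \<le> B"
    using x_bounded unfolding bounded_iff by blast
  define Z where "Z \<omega> = (INF s\<in>{2..}. f (x s \<omega>))" for \<omega>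
  \<comment> \<open>A real infimum is a lower bound of its family only once the family is known to
    be bounded below.\<close>
  have bdd: "bdd_below ((\<lambda>s. f (x s \<omega>)) ` {2..})" if "\<omega> \<in> space M" for \<omega>
    using F[OF that] by (intro bdd_belowI2[where m="- F"]) (simp add: abs_le_iff minus_le_iff)
  have Z_meas [measurable]: "Z \<in> borel_measurable M"
    unfolding Z_def using bdd by (intro borel_measurable_cINF) auto
  have Z_le: "Z \<omega> \<le> f (x s \<omega>)" if "\<omega> \<in> space M" "2 \<le> s" for s \<omega>
    unfolding Z_def using bdd that by (intro cINF_lower) auto
  have Z_ge: "f x_star \<le> Z \<omega>" if "\<omega> \<in> space M" for \<omega>
    unfolding Z_def using that x_star least iterate_in_X by (intro cINF_greatest) auto
  have Z_int: "integrable M Z"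
  proof (rule integrable_const_bound)
    show "AE \<omega> in M. norm (Z \<omega>) \<le> F + \<bar>f x_star\<bar>"
      using AE_space
    proof eventually_elim
      case (elim \<omega>)
      show ?case using Z_le[OF elim, of 2] Z_ge[OF elim] F[OF elim, of 2] by auto
    qed
  qed simp
  \<comment> \<open>Any finite distance bound will do here, because only the order of growth in
    \<open>k\<close> matters.\<close>
  define R where "R = B + norm x_star"
  have xR: "norm (x s \<omega> - x_star) \<le> R" if "\<omega> \<in> space M" for s \<omega>
    using B[OF that, of s] norm_triangle_ineq4[of "x s \<omega>" x_star] by (simp add: R_def)
  have R0: "0 \<le> R"
    using xR not_empty order_trans[OF norm_ge_zero] by blast
  have near: "AE \<omega> in M. \<exists>u\<in>X. f u = f x_star \<and> (\<forall>s\<ge>1. norm (x s \<omega> - u) \<le> R)"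
    using AE_space by eventually_elim (use x_star xR in blast)
  have "expectation Z - f x_star \<le> 0"
  proof (rule nonpos_of_sqrt_growth)
    fix k :: nat assume k: "1 \<le> k"
    have "expectation Z \<le> expectation (\<lambda>\<omega>. f (x s \<omega>))" if "2 \<le> s" for s
      using Z_int objective_integrable that Z_le by (intro integral_mono) auto
    then have "(\<Sum>s=2..k. expectation Z - f x_star)
        \<le> (\<Sum>s=2..k. expectation (\<lambda>\<omega>. f (x s \<omega>)) - f x_star)"
      by (intro sum_mono) auto
    then have "(expectation (\<lambda>\<omega>. f (x 1 \<omega>)) - f x_star) + (real k - 1) * (expectation Z - f x_star)
        \<le> (expectation (\<lambda>\<omega>. f (x 1 \<omega>)) - f x_star)
          + (\<Sum>s=2..k. expectation (\<lambda>\<omega>. f (x s \<omega>)) - f x_star)"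
      using k by (simp add: of_nat_diff)
    also have "\<dots> = (\<Sum>s=1..k. expectation (\<lambda>\<omega>. f (x s \<omega>)) - f x_star)"
      using k by (subst sum.atLeast_Suc_atMost[of 1]) (auto simp: numeral_2_eq_2)
    also have "\<dots> \<le> (R\<^sup>2 / (2 * a) + a * (G + 2 * C * R)) * sqrt (real k)"
      by (rule expected_regret[OF R0 near k])
    finally show "(expectation (\<lambda>\<omega>. f (x 1 \<omega>)) - f x_star)
        + (real k - 1) * (expectation Z - f x_star)
        \<le> (R\<^sup>2 / (2 * a) + a * (G + 2 * C * R)) * sqrt (real k)" .
  qed
  moreover have "expectation (\<lambda>\<omega>. Z \<omega> - f x_star) = expectation Z - f x_star"
    using Z_int by (simp add: prob_space)
  moreover have "AE \<omega> in M. 0 \<le> Z \<omega> - f x_star"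
    using AE_space by eventually_elim (use Z_ge in auto)
  moreover from this have "0 \<le> expectation (\<lambda>\<omega>. Z \<omega> - f x_star)"
    by (rule integral_nonneg_AE)
  \<comment> \<open>A nonnegative variable with nonpositive mean vanishes almost surely.\<close>
  ultimately have "AE \<omega> in M. Z \<omega> - f x_star = 0"
    using Z_int by (subst integral_nonneg_eq_0_iff_AE[symmetric]) auto
  then show ?thesis by (simp add: Z_def)
qed

text \<open>On the compact closure of the run from index 2 on, \<open>f\<close> attains a minimum.
  Its value is at most the infimum along the run, hence equals \<open>f x_star\<close>. The point
  lies in \<open>X\<close> as \<open>X\<close> is closed, and the distance bound passes to the
  closure because balls \<open>cball (x s \<omega>) \<Theta>\<close> are closed.\<close>

lemma minimizer_near_iterates:
  assumes min: "is_arg_min f (\<lambda>u. u \<in> X) x_star"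
    and \<Theta>: "\<And>i j \<omega>. \<omega> \<in> space M \<Longrightarrow> norm (x i \<omega> - x j \<omega>) \<le> \<Theta>"
  shows "AE \<omega> in M. \<exists>u\<in>X. f u = f x_star \<and> (\<forall>s\<ge>1. norm (x s \<omega> - u) \<le> \<Theta>)"
  using infimum_along_iterates[OF min] AE_space
proof eventually_elim
  case (elim \<omega>)
  have x_star: "x_star \<in> X" and least: "\<And>u. u \<in> X \<Longrightarrow> f x_star \<le> f u"
    using min by (auto simp: is_arg_min_linorder)
  define K where "K = closure ((\<lambda>s. x s \<omega>) ` {2..})"
  have "bounded ((\<lambda>s. x s \<omega>) ` {2..})"
    using x_bounded by (rule bounded_subset) (use elim in auto)
  then have "compact K" by (simp add: K_def compact_closure)
  then obtain u where u: "u \<in> K" "\<And>v. v \<in> K \<Longrightarrow> f u \<le> f v"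
    using continuous_attains_inf[of K f] f_cont by (auto simp: K_def intro: continuous_on_subset)
  have "f u \<le> (INF s\<in>{2..}. f (x s \<omega>))"
    using u(2) closure_subset[of "(\<lambda>s. x s \<omega>) ` {2..}"]
    by (intro cINF_greatest) (auto simp: K_def)
  moreover have uX: "u \<in> X"
  proof -
    have "K \<subseteq> X"
      unfolding K_def using iterate_in_X x_star elim closed_X by (intro closure_minimal) auto
    then show ?thesis using u by blast
  qed
  ultimately have "f u = f x_star"
    using elim least by force
  moreover have "norm (x s \<omega> - u) \<le> \<Theta>" for s
  proof -
    have "K \<subseteq> cball (x s \<omega>) \<Theta>"
      unfolding K_def using \<Theta> elim by (intro closure_minimal) (auto simp: dist_norm)
    then show ?thesis using u(1) by (auto simp: dist_norm)
  qed
  ultimately show ?case using uX by blast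
qed

text \<open>The minimum is at most the average over the indices 1 to \<open>k\<close>; including
  index 0 can only lower it.\<close>

lemma best_iterate_rate:
  assumes min: "is_arg_min f (\<lambda>u. u \<in> X) x_star"
    and \<Theta>0: "0 \<le> \<Theta>" and \<Theta>: "\<And>i j \<omega>. \<omega> \<in> space M \<Longrightarrow> norm (x i \<omega> - x j \<omega>) \<le> \<Theta>"
    and k: "1 \<le> k"
  shows "Min ((\<lambda>s. expectation (\<lambda>\<omega>. f (x s \<omega>))) ` {0..k}) - f x_star
    \<le> (\<Theta>\<^sup>2 / (2 * a) + a * (G + 2 * C * \<Theta>)) / sqrt (real k)"
proof -
  define \<mu> where "\<mu> = Min ((\<lambda>s. expectation (\<lambda>\<omega>. f (x s \<omega>))) ` {0..k}) - f x_star"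
  have "real k * \<mu> = (\<Sum>s=1..k. \<mu>)" by simp
  also have "\<dots> \<le> (\<Sum>s=1..k. expectation (\<lambda>\<omega>. f (x s \<omega>)) - f x_star)"
    unfolding \<mu>_def by (intro sum_mono diff_right_mono Min_le) auto
  also have "\<dots> \<le> (\<Theta>\<^sup>2 / (2 * a) + a * (G + 2 * C * \<Theta>)) * sqrt (real k)"
    by (rule expected_regret[OF \<Theta>0 minimizer_near_iterates[OF min \<Theta>] k])
  also have "\<dots> = real k * ((\<Theta>\<^sup>2 / (2 * a) + a * (G + 2 * C * \<Theta>)) / sqrt (real k))"
    by (metis mult.commute of_nat_0_le_iff real_div_sqrt times_divide_eq_right)
  finally have "\<mu> \<le> (\<Theta>\<^sup>2 / (2 * a) + a * (G + 2 * C * \<Theta>)) / sqrt (real k)"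
    by (rule mult_left_le_imp_le) (use k in simp)
  then show ?thesis by (simp add: \<mu>_def)
qed

end

section \<open>Norms of data and residuals\<close>

lemma mnorm_nonneg: "0 \<le> mnorm A"
  unfolding mnorm_def by (intro onorm_pos_le) simp

lemma mnorm_triangle: "mnorm (A + B) \<le> mnorm A + mnorm B"
proof -
  have "(*v) (A + B) = (\<lambda>u. A *v u + B *v u)"
    by (simp add: fun_eq_iff matrix_vector_mult_add_rdistrib)
  then show ?thesis
    unfolding mnorm_def using onorm_triangle[of "(*v) A" "(*v) B"] by simp
qed

lemma mnorm_scaleR: "mnorm (r *\<^sub>R A) = \<bar>r\<bar> * mnorm A"
  unfolding mnorm_def using onorm_scaleR[of "(*v) A" r]
  by (simp add: scaleR_matrix_vector_assoc)

lemma mnorm_minus: "mnorm (- A) = mnorm A"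
  using mnorm_scaleR[of "-1" A] by simp

lemma mnorm_diff_le: "mnorm (A - B) \<le> mnorm A + mnorm B"
  using mnorm_triangle[of A "- B"] by (simp add: mnorm_minus)

lemma residual_norm_diff_le:
  "residual_norm \<kappa> (r - r') \<le> residual_norm \<kappa> r + residual_norm \<kappa> r'"
  by (cases \<kappa>) (auto simp: residual_norm_def norm_triangle_ineq4 mnorm_diff_le)

text \<open>The triangle inequality holds first in each component; monotonicity of
  \<open>\<nu>\<close> on the nonnegative orthant carries it through, and then subadditivity of
  \<open>\<nu>\<close> applies.\<close>

lemma data_norm_triangle:
  assumes "product_norm \<nu>"
  shows "data_norm \<nu> (D + D') \<le> data_norm \<nu> D + data_norm \<nu> D'"
proof -
  from assms have tri: "\<nu> (s + t) \<le> \<nu> s + \<nu> t"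
    and mono: "\<lbrakk>0 \<le> a; a \<le> a'; 0 \<le> b; b \<le> b'; 0 \<le> c; c \<le> c'; 0 \<le> d; d \<le> d'\<rbrakk>
      \<Longrightarrow> \<nu> (a, b, c, d) \<le> \<nu> (a', b', c', d')" for s t a b c d a' b' c' d'
    unfolding product_norm_def by blast+
  obtain a b A B a' b' A' B' where D: "D = (a, b, A, B)" "D' = (a', b', A', B')"
    by (metis prod.exhaust)
  have "\<nu> (norm (a + a'), norm (b + b'), mnorm (A + A'), mnorm (B + B'))
      \<le> \<nu> (norm a + norm a', norm b + norm b', mnorm A + mnorm A', mnorm B + mnorm B')"
    by (intro mono norm_triangle_ineq mnorm_triangle mnorm_nonneg norm_ge_zero)
  also have "\<dots> \<le> \<nu> (norm a, norm b, mnorm A, mnorm B) + \<nu> (norm a', norm b', mnorm A', mnorm B')"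
    using tri[of "(norm a, norm b, mnorm A, mnorm B)" "(norm a', norm b', mnorm A', mnorm B')"]
    by simp
  finally show ?thesis by (simp add: data_norm_def D)
qed

lemma data_norm_scaleR:
  assumes "product_norm \<nu>"
  shows "data_norm \<nu> (r *\<^sub>R D) = \<bar>r\<bar> * data_norm \<nu> D"
proof -
  obtain a b A B where D: "D = (a, b, A, B)" by (metis prod.exhaust)
  have "\<nu> (\<bar>r\<bar> *\<^sub>R (norm a, norm b, mnorm A, mnorm B))
      = \<bar>\<bar>r\<bar>\<bar> * \<nu> (norm a, norm b, mnorm A, mnorm B)"
    using assms unfolding product_norm_def by blast
  then show ?thesis by (simp add: data_norm_def D mnorm_scaleR)
qed

text \<open>The norm of \<open>D + (- D)\<close> is 0 and at most twice the norm of
  \<open>D\<close>.\<close>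

lemma data_norm_nonneg:
  assumes "product_norm \<nu>"
  shows "0 \<le> data_norm \<nu> D"
  using data_norm_triangle[OF assms, of D "- D"] data_norm_scaleR[OF assms, of "-1" D]
    data_norm_scaleR[OF assms, of 0 D] by simp

text \<open>A seminorm is convex, and a finite convex function on a Euclidean space is continuous.
  This makes the norm of random data a random variable.\<close>

lemma borel_measurable_data_norm:
  assumes "product_norm \<nu>"
  shows "(data_norm \<nu> :: ('n::finite, 'p::finite) data \<Rightarrow> real) \<in> borel_measurable borel"
proof (rule borel_measurable_continuous_onI, rule convex_on_continuous)
  show "convex_on UNIV (data_norm \<nu> :: ('n, 'p) data \<Rightarrow> real)"
  proof (rule convex_onI)
    fix t :: real and D D' :: "('n, 'p) data"
    assume "0 < t" "t < 1"
    then show "data_norm \<nu> ((1 - t) *\<^sub>R D + t *\<^sub>R D') \<le> (1 - t) * data_norm \<nu> D + t * data_norm \<nu> D'"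
      using data_norm_triangle[OF assms, of "(1 - t) *\<^sub>R D" "t *\<^sub>R D'"]
      by (simp add: data_norm_scaleR[OF assms])
  qed simp
qed simp

text \<open>The definite description in \<open>grad\<close> is resolved by uniqueness of the Frechet
  derivative.\<close>

lemma grad_eqI: "GDERIV f x :> D \<Longrightarrow> grad f x = D"
  unfolding grad_def
proof (rule the_equality)
  fix D' assume "GDERIV f x :> D" "GDERIV f x :> D'"
  then have "(\<lambda>h. h \<bullet> D') = (\<lambda>h. h \<bullet> D)"
    unfolding gderiv_def by (rule has_derivative_unique[rotated])
  then show "D' = D"
    by (metis vector_eq_ldot)
qed

section \<open>Moments of the directions\<close>

context bsg_run
begin

text \<open>By the tower property a constant bound on the conditional expectation bounds the full
  expectation. Working in \<open>ennreal\<close>, finiteness of the integral also yields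
  integrability.\<close>

lemma expectation_le_of_cond_exp:
  assumes Z [measurable]: "Z \<in> borel_measurable M" and nonneg: "\<And>\<omega>. 0 \<le> Z \<omega>"
    and c: "0 \<le> c" and le: "AE \<omega> in M. cond_exp_given k Z \<omega> \<le> ennreal c"
  shows "integrable M Z" and "expectation Z \<le> c"
proof -
  let ?F = "vimage_algebra (space M) (x k) borel"
  have "subalgebra M ?F"
    unfolding subalgebra_def using x_rv[of k]
    by (auto simp: sets_vimage_algebra2 intro: measurable_sets)
  then interpret F: finite_measure_subalgebra M ?F
    by unfold_locales
  have "(\<integral>\<^sup>+\<omega>. ennreal (Z \<omega>) \<partial>M) = (\<integral>\<^sup>+\<omega>. cond_exp_given k Z \<omega> \<partial>M)"
    \<comment> \<open>The tower property is the defining identity tested with the constant function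
      1.\<close>
    unfolding cond_exp_given_def using F.nn_cond_exp_intg[of "\<lambda>_. 1" "\<lambda>\<omega>. ennreal (Z \<omega>)"] by simp
  also have "\<dots> \<le> (\<integral>\<^sup>+\<omega>. ennreal c \<partial>M)"
    by (rule nn_integral_mono_AE[OF le])
  also have "\<dots> = ennreal c" by (simp add: emeasure_space_1)
  finally have nn: "(\<integral>\<^sup>+\<omega>. ennreal (Z \<omega>) \<partial>M) \<le> ennreal c" .
  then show int: "integrable M Z"
    using nonneg by (intro integrableI_nonneg) (auto simp: le_less_trans[OF _ ennreal_less_top])
  show "expectation Z \<le> c"
    using nn nonneg c by (simp add: nn_integral_eq_integral[OF int])
qed

end

context bsg_assumptions
begin

text \<open>The second moment comes from the accuracy assumption. The first follows from it because
  a variance is nonnegative, that is, by Jensen's inequality for the square.\<close>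

lemma LL_error_moments:
  assumes k: "1 \<le> k" "0 < \<alpha> k"
  shows "integrable M (\<lambda>\<omega>. (norm (w (x k \<omega>) - wt k \<omega>))\<^sup>2)"
    and "expectation (\<lambda>\<omega>. (norm (w (x k \<omega>) - wt k \<omega>))\<^sup>2) \<le> (C_w * \<alpha> k)\<^sup>2"
    and "integrable M (\<lambda>\<omega>. norm (w (x k \<omega>) - wt k \<omega>))"
    and "expectation (\<lambda>\<omega>. norm (w (x k \<omega>) - wt k \<omega>)) \<le> C_w * \<alpha> k"
proof -
  let ?W = "\<lambda>\<omega>. norm (w (x k \<omega>) - wt k \<omega>)"
  have [measurable]: "?W \<in> borel_measurable M"
    using w_rv[OF k(1)] wt_rv[OF k(1)] by measurable
  show sq: "integrable M (\<lambda>\<omega>. (?W \<omega>)\<^sup>2)" and sq_le: "expectation (\<lambda>\<omega>. (?W \<omega>)\<^sup>2) \<le> (C_w * \<alpha> k)\<^sup>2"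
    by (rule expectation_le_of_cond_exp[OF _ _ _ LL_accuracy[OF k(1)]]; simp)+
  show int: "integrable M ?W"
    by (rule square_integrable_imp_integrable[OF _ sq]) simp
  have c: "0 < C_w * \<alpha> k"
    using positive k by simp
  have "(expectation ?W)\<^sup>2 \<le> expectation (\<lambda>\<omega>. (?W \<omega>)\<^sup>2)"
    using variance_positive[of ?W] variance_eq[OF int sq] by simp
  with sq_le have "(expectation ?W)\<^sup>2 \<le> (C_w * \<alpha> k)\<^sup>2" by simp
  then show "expectation ?W \<le> C_w * \<alpha> k"
    by (rule power2_le_imp_le) (use c in simp)
qed

text \<open>The direction is compared with the stochastic direction at the exact
  \<open>w (x k \<omega>)\<close>, whose second moment is at most \<open>V\<^sub>d\<close>. The
  outer factor 2 in \<open>const_G\<^sub>d\<close> comes from bounding the square of a sum by twice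
  the sum of squares.\<close>

lemma direction_second_moment:
  assumes k: "1 \<le> k" "0 < \<alpha> k" "\<alpha> k \<le> C_s"
  shows "integrable M (\<lambda>\<omega>. (norm (dir_at k Sto_Approx \<omega>))\<^sup>2)"
    and "expectation (\<lambda>\<omega>. (norm (dir_at k Sto_Approx \<omega>))\<^sup>2)
      \<le> const_G\<^sub>d V\<^sub>d L_BSG C_s L_LL_bar C_w C_e"
proof -
  let ?W = "\<lambda>\<omega>. norm (w (x k \<omega>) - wt k \<omega>)"
  let ?d = "\<lambda>\<omega>. (norm (dir_at k Sto_Approx \<omega>))\<^sup>2" and ?d' = "\<lambda>\<omega>. (norm (dir_at k Sto_Opt \<omega>))\<^sup>2"
  \<comment> \<open>The square of \<open>L_LL_bar * ?W \<omega> + 2 * C_e * \<alpha> k\<close> is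
    expanded, so that its expectation involves only the first two moments of
    \<open>?W\<close>.\<close>
  let ?h = "\<lambda>\<omega>. 2 * (?d' \<omega> + L_BSG\<^sup>2 * (L_LL_bar\<^sup>2 * (?W \<omega>)\<^sup>2
    + 4 * L_LL_bar * C_e * \<alpha> k * ?W \<omega> + 4 * C_e\<^sup>2 * (\<alpha> k)\<^sup>2))"
  note [measurable] = dir_rv[OF k(1)]
  note W = LL_error_moments[OF k(1,2)]
  have d': "integrable M ?d'" "expectation ?d' \<le> V\<^sub>d"
    using positive bounded_second_moment[OF k(1)]
    by (auto intro!: expectation_le_of_cond_exp[where k=k and c=V\<^sub>d])
  have le: "?d \<omega> \<le> ?h \<omega>" if \<omega>: "\<omega> \<in> space M" for \<omega>
  proof -
    let ?u = "dir_at k Sto_Opt \<omega>" and ?v = "dir_at k Sto_Approx \<omega>"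
    have "norm (?u - ?v) \<le> L_BSG * (data_norm \<nu> (datum_at k Sto_Opt \<omega> - datum_at k Sto_Approx \<omega>)
        + residual_norm \<kappa> (\<rho> k Sto_Opt \<omega> - \<rho> k Sto_Approx \<omega>))"
      by (rule direction_Lipschitz[OF k(1) \<omega>])
    \<comment> \<open>Two residuals, each at most \<open>C_e * \<alpha> k\<close>, give the constant
      \<open>2 * C_e\<close>.\<close>
    also have "\<dots> \<le> L_BSG * (L_LL_bar * ?W \<omega> + 2 * C_e * \<alpha> k)"
      using positive stochastic_data_Lipschitz[OF k(1) \<omega>] residual_bound[OF k(1) \<omega>, of Sto_Opt]
        residual_bound[OF k(1) \<omega>, of Sto_Approx]
        residual_norm_diff_le[of \<kappa> "\<rho> k Sto_Opt \<omega>" "\<rho> k Sto_Approx \<omega>"]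
      by (intro mult_left_mono) auto
    finally have "(norm (?u - ?v))\<^sup>2 \<le> (L_BSG * (L_LL_bar * ?W \<omega> + 2 * C_e * \<alpha> k))\<^sup>2"
      by (simp add: power_mono)
    moreover have "(norm ?v)\<^sup>2 \<le> 2 * ((norm ?u)\<^sup>2 + (norm (?u - ?v))\<^sup>2)"
    proof -
      have "(norm ?v)\<^sup>2 \<le> (norm ?u + norm (?u - ?v))\<^sup>2"
        using norm_triangle_ineq4[of ?u "?u - ?v"] by (intro power_mono) auto
      also have "\<dots> \<le> 2 * ((norm ?u)\<^sup>2 + (norm (?u - ?v))\<^sup>2)"
        using sum_squares_bound[of "norm ?u" "norm (?u - ?v)"]
        by (simp add: power2_sum)
      finally show ?thesis .
    qed
    ultimately show ?thesis
      by (simp add: power2_eq_square algebra_simps)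
  qed
  have h: "integrable M ?h"
    using W d' by simp
  show d: "integrable M ?d"
  proof (rule Bochner_Integration.integrable_bound[OF h])
    show "AE \<omega> in M. norm (?d \<omega>) \<le> norm (?h \<omega>)"
      using AE_space by eventually_elim (use le in \<open>force intro: order_trans[OF _ abs_ge_self]\<close>)
  qed simp
  have "expectation ?d \<le> expectation ?h"
    using d h le by (intro integral_mono) auto
  also have "\<dots> = 2 * (expectation ?d' + L_BSG\<^sup>2 * (L_LL_bar\<^sup>2 * expectation (\<lambda>\<omega>. (?W \<omega>)\<^sup>2)
      + 4 * L_LL_bar * C_e * \<alpha> k * expectation ?W + 4 * C_e\<^sup>2 * (\<alpha> k)\<^sup>2))"
    using W d' by (simp add: prob_space)
  also have "\<dots> \<le> 2 * (V\<^sub>d + L_BSG\<^sup>2 * (L_LL_bar\<^sup>2 * (C_w * \<alpha> k)\<^sup>2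
      + 4 * L_LL_bar * C_e * \<alpha> k * (C_w * \<alpha> k) + 4 * C_e\<^sup>2 * (\<alpha> k)\<^sup>2))"
    using W d' positive k
    by (intro mult_left_mono add_mono order_refl) auto
  also have "\<dots> = 2 * (V\<^sub>d + L_BSG\<^sup>2 * (\<alpha> k)\<^sup>2
      * (L_LL_bar\<^sup>2 * C_w\<^sup>2 + 4 * L_LL_bar * C_e * C_w + 4 * C_e\<^sup>2))"
    by (simp add: power2_eq_square algebra_simps)
  \<comment> \<open>Replacing \<open>\<alpha> k\<close> by \<open>C_s\<close> makes the bound
    uniform in \<open>k\<close>.\<close>
  also have "\<dots> \<le> 2 * (V\<^sub>d + L_BSG\<^sup>2 * C_s\<^sup>2
      * (L_LL_bar\<^sup>2 * C_w\<^sup>2 + 4 * L_LL_bar * C_e * C_w + 4 * C_e\<^sup>2))"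
    using positive k by (intro mult_left_mono add_left_mono mult_right_mono power_mono) auto
  finally show "expectation ?d \<le> const_G\<^sub>d V\<^sub>d L_BSG C_s L_LL_bar C_w C_e"
    by (simp add: const_G\<^sub>d_def const_U\<^sub>d_def)
qed

text \<open>The path from the exact to the computed direction goes through
  \<open>Det_Approx\<close>: the first leg is governed by the lower-level error, the second by the
  data error. Each leg involves two residuals, whence \<open>4 * C_e\<close>.\<close>

lemma direction_error:
  assumes k: "1 \<le> k" "0 < \<alpha> k"
  shows "integrable M (\<lambda>\<omega>. norm (dir_at k Det_Opt \<omega> - dir_at k Sto_Approx \<omega>))"
    and "expectation (\<lambda>\<omega>. norm (dir_at k Det_Opt \<omega> - dir_at k Sto_Approx \<omega>))
      \<le> const_C\<^sub>d L_BSG L_LL C_w C_D C_e * \<alpha> k"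
proof -
  let ?W = "\<lambda>\<omega>. norm (w (x k \<omega>) - wt k \<omega>)"
  let ?D = "\<lambda>\<omega>. data_norm \<nu> (datum_at k Det_Approx \<omega> - datum_at k Sto_Approx \<omega>)"
  let ?e = "\<lambda>\<omega>. norm (dir_at k Det_Opt \<omega> - dir_at k Sto_Approx \<omega>)"
  let ?h = "\<lambda>\<omega>. L_BSG * (L_LL * ?W \<omega> + ?D \<omega> + 4 * C_e * \<alpha> k)"
  note [measurable] = dir_rv[OF k(1)] datum_rv[OF k(1)] borel_measurable_data_norm[OF norm_\<nu>]
  note W = LL_error_moments[OF k]
  have D_meas: "?D \<in> borel_measurable M"
    by measurable
  have D: "integrable M ?D" "expectation ?D \<le> C_D * \<alpha> k"
    by (rule expectation_le_of_cond_exp[OF D_meas data_norm_nonneg[OF norm_\<nu>] _ data_accuracy[OF k(1)]],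
        use k positive in simp)+
  have le: "?e \<omega> \<le> ?h \<omega>" if \<omega>: "\<omega> \<in> space M" for \<omega>
  proof -
    have residual: "residual_norm \<kappa> (\<rho> k i \<omega> - \<rho> k j \<omega>) \<le> 2 * C_e * \<alpha> k" for i j
      using residual_norm_diff_le[of \<kappa> "\<rho> k i \<omega>" "\<rho> k j \<omega>"] residual_bound[OF k(1) \<omega>, of i]
        residual_bound[OF k(1) \<omega>, of j] by simp
    have "norm (dir_at k Det_Opt \<omega> - dir_at k Det_Approx \<omega>)
        \<le> L_BSG * (data_norm \<nu> (datum_at k Det_Opt \<omega> - datum_at k Det_Approx \<omega>)
          + residual_norm \<kappa> (\<rho> k Det_Opt \<omega> - \<rho> k Det_Approx \<omega>))"
      by (rule direction_Lipschitz[OF k(1) \<omega>])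
    also have "\<dots> \<le> L_BSG * (L_LL * ?W \<omega> + 2 * C_e * \<alpha> k)"
      using positive by (intro mult_left_mono add_mono L_LL[OF k(1) \<omega>] residual) auto
    finally have 1: "norm (dir_at k Det_Opt \<omega> - dir_at k Det_Approx \<omega>)
        \<le> L_BSG * (L_LL * ?W \<omega> + 2 * C_e * \<alpha> k)" .
    have "norm (dir_at k Det_Approx \<omega> - dir_at k Sto_Approx \<omega>)
        \<le> L_BSG * (?D \<omega> + residual_norm \<kappa> (\<rho> k Det_Approx \<omega> - \<rho> k Sto_Approx \<omega>))"
      by (rule direction_Lipschitz[OF k(1) \<omega>])
    also have "\<dots> \<le> L_BSG * (?D \<omega> + 2 * C_e * \<alpha> k)"
      using positive by (intro mult_left_mono add_mono residual order_refl) auto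
    finally have 2: "norm (dir_at k Det_Approx \<omega> - dir_at k Sto_Approx \<omega>)
        \<le> L_BSG * (?D \<omega> + 2 * C_e * \<alpha> k)" .
    have "?e \<omega> \<le> norm (dir_at k Det_Opt \<omega> - dir_at k Det_Approx \<omega>)
        + norm (dir_at k Det_Approx \<omega> - dir_at k Sto_Approx \<omega>)"
      by (rule norm_diff_triangle_le[OF order_refl order_refl])
    with 1 2 show ?thesis by (simp add: algebra_simps)
  qed
  have h: "integrable M ?h"
    using W D by simp
  show e: "integrable M ?e"
  proof (rule Bochner_Integration.integrable_bound[OF h])
    show "AE \<omega> in M. norm (?e \<omega>) \<le> norm (?h \<omega>)"
      using AE_space by eventually_elim (use le in \<open>force intro: order_trans[OF _ abs_ge_self]\<close>)
  qed simp
  have "expectation ?e \<le> expectation ?h"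
    using e h le by (intro integral_mono) auto
  also have "\<dots> = L_BSG * (L_LL * expectation ?W + expectation ?D + 4 * C_e * \<alpha> k)"
    using W D by (simp add: prob_space)
  also have "\<dots> \<le> L_BSG * (L_LL * (C_w * \<alpha> k) + C_D * \<alpha> k + 4 * C_e * \<alpha> k)"
    using W D positive by (intro mult_left_mono add_mono order_refl) auto
  also have "\<dots> = const_C\<^sub>d L_BSG L_LL C_w C_D C_e * \<alpha> k"
    by (simp add: const_C\<^sub>d_def algebra_simps)
  finally show "expectation ?e \<le> const_C\<^sub>d L_BSG L_LL C_w C_D C_e * \<alpha> k" .
qed

section \<open>The rate for general lower-level data\<close>

text \<open>With residual zero, both kinds of inexactness reduce to the adjoint formula. This links
  the directions of the method to the gradient in the convexity inequality.\<close>

lemma exact_direction: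
  assumes "adjoint_gradient f w D" "1 \<le> k" "\<omega> \<in> space M"
  shows "dir_at k Det_Opt \<omega> = - grad f (x k \<omega>)"
proof -
  obtain a b A B where D: "D (x k \<omega>) (w (x k \<omega>)) = (a, b, A, B)"
    by (metis prod.exhaust)
  with assms(1) have "GDERIV f (x k \<omega>) :> a - A *v (matrix_inv B *v b)"
    unfolding adjoint_gradient_def by (metis (mono_tags, lifting) case_prod_conv)
  then show ?thesis
    using exact[OF assms(2,3)] D unfolding dir_at_def
    by (cases \<kappa>) (simp_all add: direction_def grad_eqI zero_prod_def)
qed

text \<open>Stated for arbitrary \<open>w\<close> and data, so that the unconstrained and the
  constrained lower level are both instances.\<close>

lemma best_iterate_rate_BSG:
  assumes X: "closed X" "convex X" and adj: "adjoint_gradient f w D"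
    and bnd: "bounded {x j \<omega> | j \<omega>. \<omega> \<in> space M}"
    and \<Theta>: "0 < \<Theta>" "\<And>j1 j2 \<omega>. \<omega> \<in> space M \<Longrightarrow> norm (x j1 \<omega> - x j2 \<omega>) \<le> \<Theta>"
    and conv: "\<And>u v. f v \<ge> f u + grad f u \<bullet> (v - u)"
    and min: "is_arg_min f (\<lambda>u. u \<in> X) x_star"
    and steps: "0 < \<alpha>_bar" "\<And>j. 1 \<le> j \<Longrightarrow> \<alpha> j = \<alpha>_bar / sqrt (real j)"
    and C_s: "\<And>j. 1 \<le> j \<Longrightarrow> \<alpha> j \<le> C_s"
    and k: "1 \<le> k"
  shows "Min ((\<lambda>s. \<integral>\<omega>. f (x s \<omega>) \<partial>M) ` {0..k}) - f x_star
           \<le> (\<Theta>\<^sup>2 / (2 * \<alpha>_bar)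
                + \<alpha>_bar * (const_G\<^sub>d V\<^sub>d L_BSG C_s L_LL_bar C_w C_e
                             + 2 * const_C\<^sub>d L_BSG L_LL C_w C_D C_e * \<Theta>)) / sqrt (real k)"
proof -
  let ?G = "const_G\<^sub>d V\<^sub>d L_BSG C_s L_LL_bar C_w C_e" and ?C = "const_C\<^sub>d L_BSG L_LL C_w C_D C_e"
  have pos: "0 < \<alpha> j" if "1 \<le> j" for j
    using steps that by simp
  \<comment> \<open>The exact direction is \<open>- grad f\<close>, so the error of the abstract
    scheme is the quantity bounded in \<open>direction_error\<close>.\<close>
  have error: "norm (grad f (x s \<omega>) + dir_at s Sto_Approx \<omega>)
      = norm (dir_at s Det_Opt \<omega> - dir_at s Sto_Approx \<omega>)" if "1 \<le> s" "\<omega> \<in> space M" for s \<omega>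
    using exact_direction[OF adj that] norm_minus_cancel[of "grad f (x s \<omega>) + dir_at s Sto_Approx \<omega>"]
    by simp
  \<comment> \<open>The adjoint formula supplies a gradient at every point, and \<open>grad\<close>
    must be that gradient; continuity of \<open>f\<close> follows.\<close>
  have "GDERIV f u :> grad f u" for u
  proof -
    obtain D' where "GDERIV f u :> D'"
      using adj unfolding adjoint_gradient_def by (metis (mono_tags, lifting) case_prod_conv prod.exhaust)
    then show ?thesis using grad_eqI by metis
  qed
  then have f_cont: "continuous_on UNIV f"
    by (intro has_derivative_continuous_on) (auto simp: gderiv_def)
  interpret inexact_projected_gradient M X f "grad f" x "\<lambda>s. dir_at s Sto_Approx" \<alpha> \<alpha>_bar ?G ?C
  proof
    show "0 \<le> ?G"
      using positive by (simp add: const_G\<^sub>d_def const_U\<^sub>d_def)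
    show "0 \<le> ?C"
      using positive by (simp add: const_C\<^sub>d_def)
    fix s :: nat assume s: "1 \<le> s"
    show "integrable M (\<lambda>\<omega>. (norm (dir_at s Sto_Approx \<omega>))\<^sup>2)"
      and "expectation (\<lambda>\<omega>. (norm (dir_at s Sto_Approx \<omega>))\<^sup>2) \<le> ?G"
      by (rule direction_second_moment[OF s pos[OF s] C_s[OF s]])+
    show "integrable M (\<lambda>\<omega>. norm (grad f (x s \<omega>) + dir_at s Sto_Approx \<omega>))"
      using direction_error(1)[OF s pos[OF s]] error[OF s]
      by (simp cong: Bochner_Integration.integrable_cong)
    show "expectation (\<lambda>\<omega>. norm (grad f (x s \<omega>) + dir_at s Sto_Approx \<omega>)) \<le> ?C * \<alpha> s"
      using direction_error(2)[OF s pos[OF s]] error[OF s]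
      by (simp cong: Bochner_Integration.integral_cong)
  qed (use X f_cont conv x_rv bnd x_step steps in auto)
  show ?thesis
    using best_iterate_rate[OF min less_imp_le[OF \<Theta>(1)] \<Theta>(2) k] .
qed

end

theorem theorem4p5:
  fixes X :: "(real^'n) set"
    and fu fl :: "(real^'n) \<times> (real^'m) \<Rightarrow> real"
    and y :: "real^'n \<Rightarrow> real^'m"
    and f :: "real^'n \<Rightarrow> real" and x_star :: "real^'n"
    \<comment> \<open>constraints and multipliers (constrained case)\<close>
    and I E :: "'c::finite set" and c :: "'c \<Rightarrow> (real^'n) \<times> (real^'m) \<Rightarrow> real"
    and z :: "real^'n \<Rightarrow> real^'c"
    \<comment> \<open>randomness and stochastic estimates\<close>
    and M :: "'o measure" and S :: "'s measure" and T :: "'t measure"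
    and \<xi>1 :: "nat \<Rightarrow> 'o \<Rightarrow> 's" and \<xi> :: "nat \<Rightarrow> 'o \<Rightarrow> 't"
    and gux :: "real^'n \<Rightarrow> real^'m \<Rightarrow> 't \<Rightarrow> real^'n"
    and guy :: "real^'n \<Rightarrow> real^'m \<Rightarrow> 't \<Rightarrow> real^'m"
    and Hxy :: "real^'n \<Rightarrow> real^'m \<Rightarrow> 't \<Rightarrow> real^'m^'n"
    and Hyy :: "real^'n \<Rightarrow> real^'m \<Rightarrow> 't \<Rightarrow> real^'m^'m"
    and Gx :: "real^'n \<Rightarrow> real^('m + 'c) \<Rightarrow> 't \<Rightarrow> real^('m + 'c)^'n"
    and Gv :: "real^'n \<Rightarrow> real^('m + 'c) \<Rightarrow> 't \<Rightarrow> real^('m + 'c)^('m + 'c)"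
    \<comment> \<open>the method\<close>
    and x0 :: "real^'n" and x :: "nat \<Rightarrow> 'o \<Rightarrow> real^'n" and \<alpha> :: "nat \<Rightarrow> real"
    and \<kappa> :: inexactness
    and LL\<^sub>u :: "nat \<Rightarrow> real^'n \<Rightarrow> real^'m \<Rightarrow> 's \<Rightarrow> real^'m"
    and w0\<^sub>u :: "real^'m" and wt\<^sub>u :: "nat \<Rightarrow> 'o \<Rightarrow> real^'m"
    and \<rho>\<^sub>u :: "nat \<Rightarrow> datum \<Rightarrow> 'o \<Rightarrow> 'm residual"
    and LL\<^sub>c :: "nat \<Rightarrow> real^'n \<Rightarrow> real^('m + 'c) \<Rightarrow> 's \<Rightarrow> real^('m + 'c)"
    and w0\<^sub>c :: "real^('m + 'c)" and wt\<^sub>c :: "nat \<Rightarrow> 'o \<Rightarrow> real^('m + 'c)"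
    and \<rho>\<^sub>c :: "nat \<Rightarrow> datum \<Rightarrow> 'o \<Rightarrow> ('m + 'c) residual"
    \<comment> \<open>constants\<close>
    and \<nu> :: "real \<times> real \<times> real \<times> real \<Rightarrow> real"
    and V\<^sub>d L_BSG L_LL L_LL_bar C_w C_D C_e C_s \<Theta> \<alpha>_bar :: real
    and k :: nat
  assumes X: "closed X" "convex X"
    and fu: "cont_diff fu" and fl: "twice_cont_diff fl"
    and f_def: "\<And>x. f x = fu (x, y x)"
    and lower_level:
      "(LL_unique_solution fl (\<lambda>x. UNIV) y \<and>
        unc_regular fu fl y T gux guy Hxy Hyy \<and>
        adjoint_gradient f y (unc_data fu fl) \<and>
        bsg_assumptions M S T \<xi>1 \<xi> X x0 x \<alpha> y (unc_data fu fl) (unc_sdata gux guy Hxy Hyy)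
          LL\<^sub>u w0\<^sub>u wt\<^sub>u \<kappa> \<rho>\<^sub>u \<nu> V\<^sub>d L_BSG L_LL L_LL_bar C_w C_D C_e)
       \<or>
       (I \<inter> E = {} \<and> I \<union> E = UNIV \<and> (\<forall>i. twice_cont_diff (c i)) \<and>
        LL_unique_solution fl (feasible I E c) y \<and>
        con_regular I E c fu fl y z T gux guy Gx Gv \<and>
        con_run_regular I E c fl Gv (\<lambda>x. vjoin (y x) (z x)) M \<xi> x wt\<^sub>c \<and>
        adjoint_gradient f (\<lambda>x. vjoin (y x) (z x)) (con_data I E c fu fl) \<and>
        bsg_assumptions M S T \<xi>1 \<xi> X x0 x \<alpha> (\<lambda>x. vjoin (y x) (z x))
          (con_data I E c fu fl) (con_sdata gux guy Gx Gv)
          LL\<^sub>c w0\<^sub>c wt\<^sub>c \<kappa> \<rho>\<^sub>c \<nu> V\<^sub>d L_BSG L_LL L_LL_bar C_w C_D C_e)"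
    and iterates_bounded: "bounded {x j \<omega> | j \<omega>. \<omega> \<in> space M}"
    and \<Theta>: "0 < \<Theta>" "\<And>j1 j2 \<omega>. \<omega> \<in> space M \<Longrightarrow> norm (x j1 \<omega> - x j2 \<omega>) \<le> \<Theta>"
    and f_C1: "cont_diff f"
    and f_convex: "\<And>x x'. f x' \<ge> f x + grad f x \<bullet> (x' - x)"
    and minimizer: "is_arg_min f (\<lambda>x. x \<in> X) x_star"
    and steps: "0 < \<alpha>_bar" "\<And>j. 1 \<le> j \<Longrightarrow> \<alpha> j = \<alpha>_bar / sqrt (real j)"
    and C_s: "0 < C_s" "\<And>j. 1 \<le> j \<Longrightarrow> \<alpha> j \<le> C_s"
    and k: "1 \<le> k"
  shows "Min ((\<lambda>s. \<integral>\<omega>. f (x s \<omega>) \<partial>M) ` {0..k}) - f x_star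
           \<le> (\<Theta>\<^sup>2 / (2 * \<alpha>_bar)
                + \<alpha>_bar * (const_G\<^sub>d V\<^sub>d L_BSG C_s L_LL_bar C_w C_e
                             + 2 * const_C\<^sub>d L_BSG L_LL C_w C_D C_e * \<Theta>)) / sqrt (real k)"
  using lower_level
proof (elim disjE conjE)
  assume "adjoint_gradient f y (unc_data fu fl)"
    and "bsg_assumptions M S T \<xi>1 \<xi> X x0 x \<alpha> y (unc_data fu fl) (unc_sdata gux guy Hxy Hyy)
          LL\<^sub>u w0\<^sub>u wt\<^sub>u \<kappa> \<rho>\<^sub>u \<nu> V\<^sub>d L_BSG L_LL L_LL_bar C_w C_D C_e"
  \<comment> \<open>The general rate is instantiated with \<open>w\<close> as the lower-level
    solution \<open>y\<close>.\<close>
  then show ?thesis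
    using X iterates_bounded \<Theta> f_convex minimizer steps C_s(2) k
    by (intro bsg_assumptions.best_iterate_rate_BSG)
next
  assume "adjoint_gradient f (\<lambda>x. vjoin (y x) (z x)) (con_data I E c fu fl)"
    and "bsg_assumptions M S T \<xi>1 \<xi> X x0 x \<alpha> (\<lambda>x. vjoin (y x) (z x))
          (con_data I E c fu fl) (con_sdata gux guy Gx Gv)
          LL\<^sub>c w0\<^sub>c wt\<^sub>c \<kappa> \<rho>\<^sub>c \<nu> V\<^sub>d L_BSG L_LL L_LL_bar C_w C_D C_e"
  \<comment> \<open>Here \<open>w\<close> joins the solution with its multipliers, and the linear
    systems have the larger index type \<open>'m + 'c\<close>.\<close>
  then show ?thesis
    using X iterates_bounded \<Theta> f_convex minimizer steps C_s(2) k
    by (intro bsg_assumptions.best_iterate_rate_BSG)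
qed

end
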